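(* Let $R:=H^\infty$, let $S:=\varinjlim C_b(\mathbb{A}_r)$ be the inductive limit $C^*$-algebra defined in the context, let $G:=(\mathbb{Z},+)$, and let $\iota:=W:\operatorname{inv} S\to\mathbb{Z}$ be the index function defined in the context, where $\operatorname{inv} S$ is the set of invertible elements of $S$. Then $W$ is well defined and the following hold. (A1) $R$ is a commutative integral domain with identity. (A2) $S$ is a unital commutative semisimple complex Banach algebra with an involution $\cdot^*$, and $R\subset S$, in the sense that the map $f\mapsto \pi_0(f):=[(f|_{\mathbb{A}_r})_{r\in(0,1)}]$ is an injective embedding of $H^\infty$ into $S$. (A3) The map $\iota=W:\operatorname{inv} S\to \mathbb{Z}$ satisfies: (I1) $W(ab)=W(a)+W(b)$ for all $a,b\in \operatorname{inv} S$; (I2) $W(a^* )=-W(a)$ for all $a\in\operatorname{inv} S$; (I3) $W$ is locally constant, that is, $W$ is continuous when $\mathbb{Z}$ is equipped with the discrete topology. (A4) An element $x\in R\cap \operatorname{inv} S$ is invertible as an element of $R$ if and only if $W(x)=0$.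
   Context: $\mathbb{D}=\{z\in\mathbb{C}:|z|<1\}$, $\mathbb{T}=\{z\in\mathbb{C}:|z|=1\}$. $H^\infty$ is the algebra of bounded holomorphic functions on $\mathbb{D}$ with pointwise operations and the supremum norm $\|f\|_\infty=\sup_{z\in\mathbb{D}}|f(z)|$. For $r\in(0,1)$ let $\mathbb{A}_r:=\{z\in\mathbb{C}: r<|z|<1\}$ and let $C_b(\mathbb{A}_r)$ be the $C^*$-algebra of bounded continuous functions $f:\mathbb{A}_r\to\mathbb{C}$ with pointwise operations, norm $\|f\|_{L^\infty(\mathbb{A}_r)}=\sup_{z\in\mathbb{A}_r}|f(z)|$ and involution $f^*(z)=\overline{f(z)}$. For $0<r\le R<1$ let $\pi_r^R:C_b(\mathbb{A}_r)\to C_b(\mathbb{A}_R)$ be restriction, $\pi_r^R(f)=f|_{\mathbb{A}_R}$. Let $\mathcal{A}$ be the $*$-subalgebra of $\prod_{r\in(0,1)}C_b(\mathbb{A}_r)$ of all $(f_r)_{r\in(0,1)}$ for which there is an index $r_0\in(0,1)$ with $\pi_r^R(f_r)=f_R$ for all $r_0\le r\le R<1$. Put $\|(f_r)\|:=\lim_{r\to1}\|f_r\|_{L^\infty(\mathbb{A}_r)}$, a seminorm on $\mathcal{A}$ with $\|f^*f\|=\|f\|^2$; let $N$ be its kernel. The quotient $\mathcal{A}/N$, with the induced norm and involution, is a $C^*$-algebra denoted $\varinjlim C_b(\mathbb{A}_r)$; $[(f_r)]$ denotes the class of $(f_r)\in\mathcal{A}$. For an invertible (i.e. nowhere vanishing)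 $h\in C(\mathbb{T})$, $w(h)\in\mathbb{Z}$ denotes its winding number around $0$. For $\rho\in(0,1)$, $\mathbb{T}_\rho=\{z:|z|=\rho\}$, and for a nowhere vanishing continuous $g$ on $\mathbb{T}_\rho$, $w(g|_{\mathbb{T}_\rho})$ denotes the winding number of $\zeta\mapsto g(\rho\zeta)$, $\zeta\in\mathbb{T}$. The index function is defined for $f=[(f_r)]\in\operatorname{inv} S$ by $$W(f)=\lim_{r\to1} w(f_r|_{\mathbb{T}_\rho}),\qquad \rho\in(r,1).$$ (Well-definedness means that for $r$ close enough to $1$ the integer $w(f_r|_{\mathbb{T}_\rho})$ makes sense and depends neither on $r$, nor on $\rho\in(r,1)$, nor on the chosen representative $(f_r)$.) A Banach algebra is semisimple if the intersection of its maximal ideals is $\{0\}$. *)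

theory Defs
  imports "HOL-Complex_Analysis.Complex_Analysis" "HOL-Algebra.QuotRing"
    "HOL-Algebra.Algebraic_Closure_Type"
begin

section \<open>Complex Banach algebras with carrier sets\<close>

record 'b normed_alg = "(complex, 'b) module" +
  nrm :: "'b \<Rightarrow> real"

record 'b star_alg = "'b normed_alg" +
  star :: "'b \<Rightarrow> 'b"

text \<open>The distance is cut off to 0 outside the carrier because
  \<^locale>\<open>Metric_space\<close> requires nonnegativity and symmetry on the whole type.\<close>

definition norm_dist :: "('b, 'm) normed_alg_scheme \<Rightarrow> 'b \<Rightarrow> 'b \<Rightarrow> real" where
  "norm_dist B x y =
     (if x \<in> carrier B \<and> y \<in> carrier B then nrm B (x \<ominus>\<^bsub>B\<^esub> y) else 0)"

definition norm_topology :: "('b, 'm) normed_alg_scheme \<Rightarrow> 'b topology" where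
  "norm_topology B = Metric_space.mtopology (carrier B) (norm_dist B)"

locale unital_commutative_banach_algebra =
  Module.algebra "ring_of_type_algebra :: complex ring" B
  for B :: "('b, 'm) normed_alg_scheme" (structure) +
  assumes nrm_nonneg: "x \<in> carrier B \<Longrightarrow> 0 \<le> nrm B x"
    and nrm_eq_0: "x \<in> carrier B \<Longrightarrow> nrm B x = 0 \<longleftrightarrow> x = \<zero>"
    and nrm_smult: "x \<in> carrier B \<Longrightarrow> nrm B (c \<odot> x) = cmod c * nrm B x"
    and nrm_triangle:
      "x \<in> carrier B \<Longrightarrow> y \<in> carrier B \<Longrightarrow> nrm B (x \<oplus> y) \<le> nrm B x + nrm B y"
    and nrm_mult:
      "x \<in> carrier B \<Longrightarrow> y \<in> carrier B \<Longrightarrow> nrm B (x \<otimes> y) \<le> nrm B x * nrm B y"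
    and nrm_one: "nrm B \<one> = 1"
    and complete: "Metric_space.mcomplete (carrier B) (norm_dist B)"

locale algebra_involution =
  fixes B :: "('b, 'm) star_alg_scheme" (structure)
  assumes star_closed: "x \<in> carrier B \<Longrightarrow> star B x \<in> carrier B"
    and star_star: "x \<in> carrier B \<Longrightarrow> star B (star B x) = x"
    and star_add:
      "x \<in> carrier B \<Longrightarrow> y \<in> carrier B \<Longrightarrow> star B (x \<oplus> y) = star B x \<oplus> star B y"
    and star_smult: "x \<in> carrier B \<Longrightarrow> star B (c \<odot> x) = cnj c \<odot> star B x"
    and star_mult:
      "x \<in> carrier B \<Longrightarrow> y \<in> carrier B \<Longrightarrow> star B (x \<otimes> y) = star B y \<otimes> star B x"

definition semisimple :: "('b, 'm) ring_scheme \<Rightarrow> bool" where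
  "semisimple B \<longleftrightarrow> \<Inter> {I. maximalideal I B} = {\<zero>\<^bsub>B\<^esub>}"

section \<open>Bounded holomorphic functions on the disc\<close>

text \<open>Functions on a subset of the plane are extensional, so that equality in the
  carrier is equality of functions on that subset.\<close>

definition H_inf :: "(complex \<Rightarrow> complex) normed_alg" where
  "H_inf =
    \<lparr>carrier = {f \<in> extensional (ball 0 1). f holomorphic_on ball 0 1 \<and> bounded (f ` ball 0 1)},
     mult = (\<lambda>f g. \<lambda>z\<in>ball 0 1. f z * g z),
     one = (\<lambda>z\<in>ball 0 1. 1),
     zero = (\<lambda>z\<in>ball 0 1. 0),
     add = (\<lambda>f g. \<lambda>z\<in>ball 0 1. f z + g z),
     smult = (\<lambda>c f. \<lambda>z\<in>ball 0 1. c * f z),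
     nrm = (\<lambda>f. SUP z\<in>ball 0 1. cmod (f z))\<rparr>"

section \<open>The inductive limit of the algebras of bounded continuous functions on annuli\<close>

definition annulus :: "real \<Rightarrow> complex set" where
  "annulus r = {z. r < cmod z \<and> cmod z < 1}"

definition Cb :: "real \<Rightarrow> (complex \<Rightarrow> complex) star_alg" where
  "Cb r =
    \<lparr>carrier = {f \<in> extensional (annulus r).
                  continuous_on (annulus r) f \<and> bounded (f ` annulus r)},
     mult = (\<lambda>f g. \<lambda>z\<in>annulus r. f z * g z),
     one = (\<lambda>z\<in>annulus r. 1),
     zero = (\<lambda>z\<in>annulus r. 0),
     add = (\<lambda>f g. \<lambda>z\<in>annulus r. f z + g z),
     smult = (\<lambda>c f. \<lambda>z\<in>annulus r. c * f z),
     nrm = (\<lambda>f. SUP z\<in>annulus r. cmod (f z)),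
     star = (\<lambda>f. \<lambda>z\<in>annulus r. cnj (f z))\<rparr>"

text \<open>In \<open>coherent_alg\<close> the field \<^const>\<open>nrm\<close> is only a seminorm.\<close>

definition coherent_alg :: "(real \<Rightarrow> complex \<Rightarrow> complex) star_alg" where
  "coherent_alg =
    \<lparr>carrier = {f \<in> (\<Pi>\<^sub>E r\<in>{0<..<1}. carrier (Cb r)).
        \<exists>r0\<in>{0<..<1}. \<forall>r R. r0 \<le> r \<and> r \<le> R \<and> R < 1 \<longrightarrow> restrict (f r) (annulus R) = f R},
     mult = (\<lambda>f g. \<lambda>r\<in>{0<..<1}. f r \<otimes>\<^bsub>Cb r\<^esub> g r),
     one = (\<lambda>r\<in>{0<..<1}. \<one>\<^bsub>Cb r\<^esub>),
     zero = (\<lambda>r\<in>{0<..<1}. \<zero>\<^bsub>Cb r\<^esub>),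
     add = (\<lambda>f g. \<lambda>r\<in>{0<..<1}. f r \<oplus>\<^bsub>Cb r\<^esub> g r),
     smult = (\<lambda>c f. \<lambda>r\<in>{0<..<1}. c \<odot>\<^bsub>Cb r\<^esub> f r),
     nrm = (\<lambda>f. Lim (at_left 1) (\<lambda>r. nrm (Cb r) (f r))),
     star = (\<lambda>f. \<lambda>r\<in>{0<..<1}. star (Cb r) (f r))\<rparr>"

definition null_ideal :: "(real \<Rightarrow> complex \<Rightarrow> complex) set" where
  "null_ideal = {f \<in> carrier coherent_alg. nrm coherent_alg f = 0}"

abbreviation coset ::
  "(real \<Rightarrow> complex \<Rightarrow> complex) \<Rightarrow> (real \<Rightarrow> complex \<Rightarrow> complex) set" where
  "coset f \<equiv> null_ideal +>\<^bsub>coherent_alg\<^esub> f"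

text \<open>The ring structure is that of the library's factor ring. Scalar multiplication, norm
  and involution are induced: \<^const>\<open>the_elem\<close> extracts the value common to all
  representatives.\<close>

definition S_alg :: "(real \<Rightarrow> complex \<Rightarrow> complex) set star_alg" where
  "S_alg =
    \<lparr>carrier = carrier (coherent_alg Quot null_ideal),
     mult = mult (coherent_alg Quot null_ideal),
     one = one (coherent_alg Quot null_ideal),
     zero = zero (coherent_alg Quot null_ideal),
     add = add (coherent_alg Quot null_ideal),
     smult = (\<lambda>c a. the_elem ((\<lambda>f. coset (c \<odot>\<^bsub>coherent_alg\<^esub> f)) ` a)),
     nrm = (\<lambda>a. the_elem (nrm coherent_alg ` a)),
     star = (\<lambda>a. the_elem ((\<lambda>f. coset (star coherent_alg f)) ` a))\<rparr>"

definition \<pi>\<^sub>0 :: "(complex \<Rightarrow> complex) \<Rightarrow> (real \<Rightarrow> complex \<Rightarrow> complex) set" where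
  "\<pi>\<^sub>0 f = coset (\<lambda>r\<in>{0<..<1}. restrict f (annulus r))"

section \<open>The index function\<close>

definition wind :: "(complex \<Rightarrow> complex) \<Rightarrow> int" where
  "wind h = (THE k. winding_number (h \<circ> circlepath 0 1) 0 = of_int k)"

text \<open>\<open>has_index f k\<close> says that, for \<open>r\<close> close enough to 1, the winding number of
  \<open>f r\<close> on every circle of radius \<open>\<rho> \<in> (r, 1)\<close> makes sense and equals \<open>k\<close>; for
  integers this is what convergence to \<open>k\<close> means.\<close>

definition has_index :: "(real \<Rightarrow> complex \<Rightarrow> complex) \<Rightarrow> int \<Rightarrow> bool" where
  "has_index f k \<longleftrightarrow>
     (\<forall>\<^sub>F r in at_left 1. \<forall>\<rho>\<in>{r<..<1}.
        (\<forall>z\<in>sphere 0 \<rho>. f r z \<noteq> 0) \<and> wind (\<lambda>\<zeta>. f r (of_real \<rho> * \<zeta>)) = k)"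

definition W :: "(real \<Rightarrow> complex \<Rightarrow> complex) set \<Rightarrow> int" where
  "W a = (THE k. \<forall>f\<in>a. has_index f k)"

end

theory Submission
  imports Defs "HOL-Algebra.Ring_Divisibility"
begin

text \<open>
  The class of a coherent family is determined by its germ at the unit circle, up to functions that
  tend to 0 there. A germ can be cut off to a bounded continuous function on the whole disc without
  changing its class, so \<^const>\<open>S_alg\<close> is the algebra of bounded continuous functions on the
  disc modulo those vanishing at the unit circle, and its norm is the limit superior of the modulus
  at the circle (\<open>S_carrier_pi0\<close>, \<open>pi0_eq_iff\<close>, \<open>pi0_ops\<close>, \<open>nrm_pi0\<close>). All statements
  about \<^const>\<open>S_alg\<close> become statements about such functions, and the algebraic and normed-algebra
  axioms follow from their pointwise counterparts. Completeness (\<open>S_complete\<close>) is the completeness of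
  uniform convergence, because representatives can be truncated to have uniform norm close to
  the quotient norm. Semisimplicity (\<open>S_semisimple\<close>) uses that an element \<open>a\<close> of all maximal
  ideals makes every \<open>1 - a * y\<close> a unit: where the modulus of a representative of \<open>a\<close> is at
  least \<open>e\<close>, it has a bounded continuous inverse \<open>y\<close>, so \<open>1 - a * y\<close> would have zeros
  accumulating at the circle.

  A unit is represented by a function \<open>F\<close> whose modulus is bounded below near the circle
  (\<open>S_unit_bounded_below\<close>). Its winding number along circles of radius near 1 does not depend on
  the radius by homotopy invariance, and by Rouche's principle it does not change when \<open>F\<close> is
  perturbed by less than the lower bound. The latter gives both independence of the representative
  (\<open>W_unit\<close>) and local constancy (\<open>W_locally_constant\<close>). Continuous logarithms give
  additivity (\<open>W_mult\<close>).

  For a bounded holomorphic function representing a unit the index is the number of zeros in the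
  disc, by the argument principle (\<open>nonvanishing_if_circle_wind_zero\<close>). If it is 0, then the
  reciprocal is holomorphic, and it is bounded by the lower bound near the circle and compactness
  elsewhere (\<open>H_inf_unit_iff\<close>). Injectivity of \<^const>\<open>\<pi>\<^sub>0\<close> on \<^const>\<open>H_inf\<close> is the
  maximum modulus principle (\<open>pi0_inj\<close>).
\<close>

section \<open>Approach to the unit circle from inside the disc\<close>

text \<open>All notions attached to the inductive limit (the seminorm, the null ideal, the index)
  depend only on the behaviour of functions on thin annuli. This filter makes that precise, so that
  estimates on annuli can be combined by \<open>eventually\<close> and limit arguments.\<close>

definition bdry :: "complex filter" where
  "bdry = filtercomap cmod (at_left 1)"

lemma eventually_bdry:
  "eventually P bdry \<longleftrightarrow> (\<exists>r\<in>{0<..<1}. \<forall>z\<in>annulus r. P z)"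
proof
  assume "eventually P bdry"
  then obtain Q where Q: "eventually Q (at_left (1::real))" "\<And>z. Q (cmod z) \<Longrightarrow> P z"
    unfolding bdry_def eventually_filtercomap by blast
  then obtain b where b: "b < 1" "\<And>y. b < y \<Longrightarrow> y < 1 \<Longrightarrow> Q y"
    unfolding eventually_at_left_field by blast
  have "max b (1/2) \<in> {0<..<1}" "\<forall>z\<in>annulus (max b (1/2)). P z"
    using b Q by (auto simp: annulus_def)
  then show "\<exists>r\<in>{0<..<1}. \<forall>z\<in>annulus r. P z" by blast
next
  assume "\<exists>r\<in>{0<..<1}. \<forall>z\<in>annulus r. P z"
  then obtain r where r: "r < 1" "\<forall>z\<in>annulus r. P z" by auto
  show "eventually P bdry"
    unfolding bdry_def eventually_filtercomap
    by (rule exI[of _ "\<lambda>y. r < y \<and> y < 1"])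
      (use r in \<open>auto simp: annulus_def eventually_at_left_field\<close>)
qed

lemma annulus_mono: "r \<le> R \<Longrightarrow> annulus R \<subseteq> annulus r"
  by (auto simp: annulus_def)

lemma of_real_mem_annulus: "0 \<le> r \<Longrightarrow> r < \<rho> \<Longrightarrow> \<rho> < 1 \<Longrightarrow> of_real \<rho> \<in> annulus r"
  by (auto simp: annulus_def)

lemma annulus_nonempty: "0 \<le> r \<Longrightarrow> r < 1 \<Longrightarrow> annulus r \<noteq> {}"
  using of_real_mem_annulus[of r "(r+1)/2"] by fastforce

lemma annulus_subset_ball: "annulus r \<subseteq> ball 0 1"
  by (auto simp: annulus_def)

lemma sphere_subset_annulus: "r < \<rho> \<Longrightarrow> \<rho> < 1 \<Longrightarrow> sphere 0 \<rho> \<subseteq> annulus r"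
  by (auto simp: annulus_def)

lemma bdry_neq_bot: "bdry \<noteq> bot"
proof -
  have "\<not> eventually (\<lambda>z. False) bdry"
    unfolding eventually_bdry using annulus_nonempty by fastforce
  then show ?thesis by auto
qed

lemma eventually_bdry_ball: "eventually (\<lambda>z. z \<in> ball 0 1 \<and> 1/2 < cmod z) bdry"
  unfolding eventually_bdry by (rule bexI[of _ "1/2"]) (auto simp: annulus_def)

section \<open>The algebra of coherent families\<close>

text \<open>The single function whose restrictions a coherent family eventually consists of. The
  radius \<open>2 * cmod z - 1\<close> is smaller than \<open>cmod z\<close>, so that \<open>z\<close> lies in the annulus on which that
  member of the family lives, and it tends to 1 with \<open>cmod z\<close>, so that coherence eventually applies.\<close>

definition germ :: "(real \<Rightarrow> complex \<Rightarrow> complex) \<Rightarrow> complex \<Rightarrow> complex" where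
  "germ f z = f (2 * cmod z - 1) z"

lemmas alg_defs = coherent_alg_def Cb_def

lemma coherent_simps:
  "one coherent_alg = (\<lambda>r\<in>{0<..<1}. \<lambda>z\<in>annulus r. 1)"
  "zero coherent_alg = (\<lambda>r\<in>{0<..<1}. \<lambda>z\<in>annulus r. 0)"
  "f \<otimes>\<^bsub>coherent_alg\<^esub> g = (\<lambda>r\<in>{0<..<1}. \<lambda>z\<in>annulus r. f r z * g r z)"
  "f \<oplus>\<^bsub>coherent_alg\<^esub> g = (\<lambda>r\<in>{0<..<1}. \<lambda>z\<in>annulus r. f r z + g r z)"
  "c \<odot>\<^bsub>coherent_alg\<^esub> f = (\<lambda>r\<in>{0<..<1}. \<lambda>z\<in>annulus r. c * f r z)"
  "star coherent_alg f = (\<lambda>r\<in>{0<..<1}. \<lambda>z\<in>annulus r. cnj (f r z))"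
  "nrm coherent_alg f = Lim (at_left 1) (\<lambda>r. SUP z\<in>annulus r. cmod (f r z))"
  by (simp_all add: alg_defs)

lemma coherent_carrier:
  "f \<in> carrier coherent_alg \<longleftrightarrow> f \<in> extensional {0<..<1} \<and>
    (\<forall>r\<in>{0<..<1}. f r \<in> extensional (annulus r) \<and> continuous_on (annulus r) (f r)
        \<and> bounded (f r ` annulus r)) \<and>
    (\<exists>r0\<in>{0<..<1}. \<forall>r R. r0 \<le> r \<and> r \<le> R \<and> R < 1 \<longrightarrow> (\<forall>z\<in>annulus R. f r z = f R z))"
  (is "_ \<longleftrightarrow> ?ext \<and> ?C \<and> ?R")
proof -
  have "f \<in> carrier coherent_alg \<longleftrightarrow> (?ext \<and> ?C) \<and>
    (\<exists>r0\<in>{0<..<1}. \<forall>r R. r0 \<le> r \<and> r \<le> R \<and> R < 1 \<longrightarrow> restrict (f r) (annulus R) = f R)"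
    by (simp add: alg_defs PiE_def Pi_def Ball_def Bex_def conj_ac)
  also have "\<dots> \<longleftrightarrow> (?ext \<and> ?C) \<and> ?R"
  proof (intro conj_cong refl bex_cong all_cong1 imp_cong)
    fix r0 r R :: real assume *: "?ext \<and> ?C" "r0 \<in> {0<..<1}" "r0 \<le> r \<and> r \<le> R \<and> R < 1"
    then have R: "f R \<in> extensional (annulus R)" by simp
    show "restrict (f r) (annulus R) = f R \<longleftrightarrow> (\<forall>z\<in>annulus R. f r z = f R z)"
    proof
      assume "restrict (f r) (annulus R) = f R"
      then show "\<forall>z\<in>annulus R. f r z = f R z" by (metis restrict_apply')
    next
      assume "\<forall>z\<in>annulus R. f r z = f R z"
      then show "restrict (f r) (annulus R) = f R"
        by (intro extensionalityI[OF restrict_extensional R]) simp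
    qed
  qed
  finally show ?thesis by (simp only: conj_assoc)
qed

lemma coherent_eqI:
  assumes "f \<in> carrier coherent_alg" "g \<in> carrier coherent_alg"
    and "\<And>r z. r \<in> {0<..<1} \<Longrightarrow> z \<in> annulus r \<Longrightarrow> f r z = g r z"
  shows "f = g"
proof (rule extensionalityI[of f "{0<..<1}" g])
  fix r :: real assume r: "r \<in> {0<..<1}"
  show "f r = g r"
    by (rule extensionalityI[of _ "annulus r"]) (use assms r in \<open>auto simp: coherent_carrier\<close>)
qed (use assms in \<open>auto simp: coherent_carrier\<close>)

lemma bounded_continuous_image2:
  fixes \<phi> :: "complex \<times> complex \<Rightarrow> complex"
  assumes \<phi>: "continuous_on UNIV \<phi>" and "bounded (f ` A)" "bounded (g ` A)"
  shows "bounded ((\<lambda>z. \<phi> (f z, g z)) ` A)"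
proof -
  have "compact (closure (f ` A \<times> g ` A))"
    using bounded_Times[OF assms(2,3)] by (simp only: compact_closure)
  then have "bounded (\<phi> ` closure (f ` A \<times> g ` A))"
    by (rule compact_imp_bounded[OF compact_continuous_image[OF continuous_on_subset[OF \<phi> subset_UNIV]]])
  moreover have "(\<lambda>z. \<phi> (f z, g z)) ` A \<subseteq> \<phi> ` (f ` A \<times> g ` A)" by auto
  ultimately show ?thesis
    by (rule bounded_subset[OF _ order_trans[OF _ image_mono[OF closure_subset]]])
qed

text \<open>All operations of the algebra are pointwise applications of a continuous map; closure
  under every one of them is proved at once.\<close>

lemma coherent_closed:
  fixes \<phi> :: "complex \<times> complex \<Rightarrow> complex"
  assumes \<phi>: "continuous_on UNIV \<phi>"
    and f: "f \<in> carrier coherent_alg" and g: "g \<in> carrier coherent_alg"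
  shows "(\<lambda>r\<in>{0<..<1}. \<lambda>z\<in>annulus r. \<phi> (f r z, g r z)) \<in> carrier coherent_alg"
proof -
  obtain r1 where r1: "r1 \<in> {0<..<1}"
    "\<And>r R. r1 \<le> r \<Longrightarrow> r \<le> R \<Longrightarrow> R < 1 \<Longrightarrow> (\<forall>z\<in>annulus R. f r z = f R z)"
    using f unfolding coherent_carrier by blast
  obtain r2 where r2: "r2 \<in> {0<..<1}"
    "\<And>r R. r2 \<le> r \<Longrightarrow> r \<le> R \<Longrightarrow> R < 1 \<Longrightarrow> (\<forall>z\<in>annulus R. g r z = g R z)"
    using g unfolding coherent_carrier by blast
  show ?thesis
    unfolding coherent_carrier
  proof (intro conjI ballI)
    fix r :: real assume r: "r \<in> {0<..<1}"
    have "continuous_on (annulus r) (\<lambda>z. (f r z, g r z))"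
      using f g r by (intro continuous_intros) (auto simp: coherent_carrier)
    then have "continuous_on (annulus r) (\<lambda>z. \<phi> (f r z, g r z))"
      by (rule continuous_on_compose2[OF \<phi>]) auto
    then show "continuous_on (annulus r) ((\<lambda>r\<in>{0<..<1}. \<lambda>z\<in>annulus r. \<phi> (f r z, g r z)) r)"
      using r by (simp cong: continuous_on_cong)
    have "bounded ((\<lambda>z. \<phi> (f r z, g r z)) ` annulus r)"
      using f g r by (intro bounded_continuous_image2 \<phi>) (auto simp: coherent_carrier)
    then show "bounded ((\<lambda>r\<in>{0<..<1}. \<lambda>z\<in>annulus r. \<phi> (f r z, g r z)) r ` annulus r)"
      using r by (simp cong: image_cong)
  next
    show "\<exists>r0\<in>{0<..<1}. \<forall>r R. r0 \<le> r \<and> r \<le> R \<and> R < 1 \<longrightarrow>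
      (\<forall>z\<in>annulus R. (\<lambda>r\<in>{0<..<1}. \<lambda>z\<in>annulus r. \<phi> (f r z, g r z)) r z =
         (\<lambda>r\<in>{0<..<1}. \<lambda>z\<in>annulus r. \<phi> (f r z, g r z)) R z)"
    proof (intro bexI[of _ "max r1 r2"] allI impI ballI)
      fix r R z assume "max r1 r2 \<le> r \<and> r \<le> R \<and> R < 1" "z \<in> annulus R"
      moreover from this have "z \<in> annulus r" using annulus_mono by blast
      ultimately show "(\<lambda>r\<in>{0<..<1}. \<lambda>z\<in>annulus r. \<phi> (f r z, g r z)) r z =
         (\<lambda>r\<in>{0<..<1}. \<lambda>z\<in>annulus r. \<phi> (f r z, g r z)) R z"
        using r1(2)[of r R] r2(2)[of r R] r1(1) r2(1) by simp
    qed (use r1 r2 in auto)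
  qed auto
qed

lemma coherent_ops_closed:
  assumes "f \<in> carrier coherent_alg"
  shows "g \<in> carrier coherent_alg \<Longrightarrow> f \<otimes>\<^bsub>coherent_alg\<^esub> g \<in> carrier coherent_alg"
    and "g \<in> carrier coherent_alg \<Longrightarrow> f \<oplus>\<^bsub>coherent_alg\<^esub> g \<in> carrier coherent_alg"
    and "c \<odot>\<^bsub>coherent_alg\<^esub> f \<in> carrier coherent_alg"
    and "star coherent_alg f \<in> carrier coherent_alg"
proof -
  have cont: "continuous_on UNIV (\<lambda>p::complex \<times> complex. fst p * snd p)"
    "continuous_on UNIV (\<lambda>p::complex \<times> complex. fst p + snd p)"
    "continuous_on UNIV (\<lambda>p::complex \<times> complex. c * fst p)"
    "continuous_on UNIV (\<lambda>p::complex \<times> complex. cnj (fst p))"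
    by (intro continuous_intros)+
  show "g \<in> carrier coherent_alg \<Longrightarrow> f \<otimes>\<^bsub>coherent_alg\<^esub> g \<in> carrier coherent_alg"
    using coherent_closed[OF cont(1) assms, of g] by (simp only: coherent_simps fst_conv snd_conv)
  show "g \<in> carrier coherent_alg \<Longrightarrow> f \<oplus>\<^bsub>coherent_alg\<^esub> g \<in> carrier coherent_alg"
    using coherent_closed[OF cont(2) assms, of g] by (simp only: coherent_simps fst_conv snd_conv)
  show "c \<odot>\<^bsub>coherent_alg\<^esub> f \<in> carrier coherent_alg"
    using coherent_closed[OF cont(3) assms assms] by (simp only: coherent_simps fst_conv)
  show "star coherent_alg f \<in> carrier coherent_alg"
    using coherent_closed[OF cont(4) assms assms] by (simp only: coherent_simps fst_conv)
qed

lemma coherent_restrict: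
  assumes "continuous_on (ball 0 1) F" "bounded (F ` ball 0 1)"
  shows "(\<lambda>r\<in>{0<..<1}. restrict F (annulus r)) \<in> carrier coherent_alg"
  unfolding coherent_carrier
proof (intro conjI ballI)
  fix r :: real assume r: "r \<in> {0<..<1}"
  have "continuous_on (annulus r) F" "bounded (F ` annulus r)"
    using continuous_on_subset[OF assms(1) annulus_subset_ball]
      bounded_subset[OF assms(2) image_mono[OF annulus_subset_ball]] by auto
  then show "continuous_on (annulus r) ((\<lambda>r\<in>{0<..<1}. restrict F (annulus r)) r)"
    "bounded ((\<lambda>r\<in>{0<..<1}. restrict F (annulus r)) r ` annulus r)"
    using r by (simp_all cong: continuous_on_cong image_cong)
next
  show "\<exists>r0\<in>{0<..<1}. \<forall>r R. r0 \<le> r \<and> r \<le> R \<and> R < 1 \<longrightarrow>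
      (\<forall>z\<in>annulus R. (\<lambda>r\<in>{0<..<1}. restrict F (annulus r)) r z =
         (\<lambda>r\<in>{0<..<1}. restrict F (annulus r)) R z)"
    by (rule bexI[of _ "1/2"]) (auto simp: annulus_def)
qed auto

lemma coherent_zero_one_closed:
  "zero coherent_alg \<in> carrier coherent_alg" "one coherent_alg \<in> carrier coherent_alg"
  using coherent_restrict[of "\<lambda>_. 0"] coherent_restrict[of "\<lambda>_. 1"]
  by (auto simp: coherent_simps image_constant_conv)

lemma coherent_at:
  assumes "r \<in> {0<..<1}" "z \<in> annulus r"
  shows "one coherent_alg r z = 1" "zero coherent_alg r z = 0"
    "(f \<otimes>\<^bsub>coherent_alg\<^esub> g) r z = f r z * g r z"
    "(f \<oplus>\<^bsub>coherent_alg\<^esub> g) r z = f r z + g r z"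
    "(c \<odot>\<^bsub>coherent_alg\<^esub> f) r z = c * f r z"
    "star coherent_alg f r z = cnj (f r z)"
  using assms by (simp_all add: coherent_simps)

lemmas coherent_intros = coherent_ops_closed coherent_zero_one_closed

lemma coherent_neg:
  assumes "x \<in> carrier coherent_alg"
  shows "(-1) \<odot>\<^bsub>coherent_alg\<^esub> x \<oplus>\<^bsub>coherent_alg\<^esub> x = \<zero>\<^bsub>coherent_alg\<^esub>"
  by (rule coherent_eqI, (intro coherent_intros assms)+) (simp add: coherent_at)

lemma coherent_cring: "cring coherent_alg"
proof (intro cringI abelian_groupI comm_monoidI)
  fix x assume "x \<in> carrier coherent_alg"
  then show "\<exists>y\<in>carrier coherent_alg. y \<oplus>\<^bsub>coherent_alg\<^esub> x = \<zero>\<^bsub>coherent_alg\<^esub>"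
    using coherent_ops_closed(3) coherent_neg by blast
qed (simp add: coherent_intros |
    (rule coherent_eqI; simp add: coherent_intros coherent_at algebra_simps))+

lemma coherent_germ:
  assumes "f \<in> carrier coherent_alg"
  obtains r0 where "r0 \<in> {0<..<1}" "\<And>r z. r0 \<le> r \<Longrightarrow> r < 1 \<Longrightarrow> z \<in> annulus r \<Longrightarrow> f r z = germ f z"
    "continuous_on (annulus r0) (germ f)" "bounded (germ f ` annulus r0)"
proof -
  obtain r1 where r1: "r1 \<in> {0<..<1}"
    "\<And>r R z. r1 \<le> r \<Longrightarrow> r \<le> R \<Longrightarrow> R < 1 \<Longrightarrow> z \<in> annulus R \<Longrightarrow> f r z = f R z"
    using assms unfolding coherent_carrier by blast
  define r0 where "r0 = (r1 + 1) / 2"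
  have r0: "r0 \<in> {0<..<1}" using r1(1) by (auto simp: r0_def)
  have eq: "f r z = germ f z" if "r0 \<le> r" "r < 1" "z \<in> annulus r" for r z
  proof -
    have z: "r < cmod z" "cmod z < 1" using that by (auto simp: annulus_def)
    have "f (2 * cmod z - 1) z = f r1 z"
      using r1(2)[of r1 "2 * cmod z - 1" z] r1(1) z that by (auto simp: annulus_def r0_def)
    moreover have "f r z = f r1 z"
      using r1(2)[of r1 r z] r1(1) that by (auto simp: annulus_def r0_def)
    ultimately show ?thesis by (simp add: germ_def)
  qed
  have "continuous_on (annulus r0) (f r0)" "bounded (f r0 ` annulus r0)"
    using assms r0 by (auto simp: coherent_carrier)
  moreover have "continuous_on (annulus r0) (f r0) \<longleftrightarrow> continuous_on (annulus r0) (germ f)"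
    by (rule continuous_on_cong) (use eq r0 in auto)
  moreover have "f r0 ` annulus r0 = germ f ` annulus r0"
    by (rule image_cong) (use eq r0 in auto)
  ultimately show ?thesis using that r0 eq by metis
qed

lemma germ_simps:
  assumes "1/2 < cmod z" "cmod z < 1"
  shows "germ (f \<otimes>\<^bsub>coherent_alg\<^esub> g) z = germ f z * germ g z"
    "germ (f \<oplus>\<^bsub>coherent_alg\<^esub> g) z = germ f z + germ g z"
    "germ (c \<odot>\<^bsub>coherent_alg\<^esub> f) z = c * germ f z"
    "germ (star coherent_alg f) z = cnj (germ f z)"
    "germ (one coherent_alg) z = 1"
    "germ (zero coherent_alg) z = 0"
    "germ (\<lambda>r\<in>{0<..<1}. restrict F (annulus r)) z = F z"
  using assms by (simp_all add: germ_def coherent_simps annulus_def)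

lemma Bfun_germ:
  assumes "f \<in> carrier coherent_alg"
  shows "Bfun (germ f) bdry"
proof -
  obtain r0 where "r0 \<in> {0<..<1}" "bounded (germ f ` annulus r0)"
    using coherent_germ[OF assms] by metis
  then obtain B where "\<And>z. z \<in> annulus r0 \<Longrightarrow> cmod (germ f z) \<le> B"
    unfolding bounded_iff by auto
  with \<open>r0 \<in> _\<close> have "eventually (\<lambda>z. cmod (germ f z) \<le> B) bdry"
    unfolding eventually_bdry by blast
  then show ?thesis by (rule BfunI)
qed

text \<open>The suprema over the annuli decrease as \<open>r\<close> tends to 1, hence converge to their infimum. The
  resulting limit superior is used below only through this characterisation, which avoids suprema.\<close>

lemma nrm_coherent:
  assumes f: "f \<in> carrier coherent_alg"
  shows nrm_coherent_nonneg: "0 \<le> nrm coherent_alg f"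
    and nrm_coherent_le_iff:
      "nrm coherent_alg f \<le> c \<longleftrightarrow> (\<forall>e>0. eventually (\<lambda>z. cmod (germ f z) \<le> c + e) bdry)"
proof -
  define h where "h r = (SUP z\<in>annulus r. cmod (germ f z))" for r
  obtain r0 where r0: "r0 \<in> {0<..<1}"
    and eq: "\<And>r z. r0 \<le> r \<Longrightarrow> r < 1 \<Longrightarrow> z \<in> annulus r \<Longrightarrow> f r z = germ f z"
    and bd: "bounded (germ f ` annulus r0)"
    using coherent_germ[OF f] by metis
  have bdd: "bdd_above ((\<lambda>z. cmod (germ f z)) ` annulus r)" if "r0 \<le> r" for r
  proof -
    obtain B where "\<And>z. z \<in> annulus r0 \<Longrightarrow> cmod (germ f z) \<le> B"
      using bd unfolding bounded_iff by auto
    then show ?thesis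
      using annulus_mono[OF that] by (auto intro!: bdd_aboveI[of _ B])
  qed
  have ne: "annulus r \<noteq> {}" if "r0 \<le> r" "r < 1" for r
    using annulus_nonempty that r0 by auto
  have mono: "h R \<le> h r" if "r0 \<le> r" "r \<le> R" "R < 1" for r R
    unfolding h_def using that by (intro cSUP_subset_mono ne bdd annulus_mono) auto
  have h0: "0 \<le> h r" if "r0 \<le> r" "r < 1" for r
  proof -
    have "annulus r \<noteq> {}" using ne that by blast
    then obtain z where "z \<in> annulus r" by blast
    then have "cmod (germ f z) \<le> h r"
      unfolding h_def using \<open>r0 \<le> r\<close> by (intro cSUP_upper bdd)
    then show ?thesis by (meson norm_ge_zero order_trans)
  qed
  define L where "L = (INF r\<in>{r0..<1}. h r)"
  have bddL: "bdd_below (h ` {r0..<1})"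
    using h0 by (auto intro!: bdd_belowI[of _ 0])
  have Lh: "L \<le> h r" if "r0 \<le> r" "r < 1" for r
    unfolding L_def using that bddL by (intro cINF_lower) auto
  have L0: "0 \<le> L"
    unfolding L_def using h0 r0 by (intro cINF_greatest) auto
  have hL: "\<exists>r. r0 \<le> r \<and> r < 1 \<and> h r < a" if "L < a" for a
  proof -
    have "{r0..<1} \<noteq> {}" using r0 by auto
    then show ?thesis
      using cINF_less_iff[OF _ bddL, of a] that unfolding L_def by auto
  qed
  have "((\<lambda>r. SUP z\<in>annulus r. cmod (f r z)) \<longlongrightarrow> L) (at_left 1)"
  proof -
    have "(h \<longlongrightarrow> L) (at_left 1)"
    proof (rule order_tendstoI)
      fix a assume "a < L"
      then show "eventually (\<lambda>r. a < h r) (at_left 1)"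
        unfolding eventually_at_left_field using r0 Lh by (intro exI[of _ r0]) (auto intro: less_le_trans)
    next
      fix a assume "L < a"
      then obtain r where "r0 \<le> r" "r < 1" "h r < a" using hL by blast
      then show "eventually (\<lambda>r. h r < a) (at_left 1)"
        unfolding eventually_at_left_field
        using le_less_trans[OF mono[of r]] by (intro exI[of _ r]) (simp add: less_imp_le)
    qed
    moreover have "eventually (\<lambda>r. h r = (SUP z\<in>annulus r. cmod (f r z))) (at_left 1)"
      unfolding eventually_at_left_field h_def
      using r0 eq by (intro exI[of _ r0]) (auto intro!: SUP_cong)
    ultimately show ?thesis by (rule Lim_transform_eventually)
  qed
  then have nrm: "nrm coherent_alg f = L"
    unfolding coherent_simps by (intro tendsto_Lim) auto
  show "0 \<le> nrm coherent_alg f" using nrm L0 by simp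
  show "nrm coherent_alg f \<le> c \<longleftrightarrow> (\<forall>e>0. eventually (\<lambda>z. cmod (germ f z) \<le> c + e) bdry)"
  proof
    assume "nrm coherent_alg f \<le> c"
    show "\<forall>e>0. eventually (\<lambda>z. cmod (germ f z) \<le> c + e) bdry"
    proof (intro allI impI)
      fix e :: real assume "e > 0"
      then have "L < c + e" using \<open>nrm coherent_alg f \<le> c\<close> nrm by simp
      then obtain r where r: "r0 \<le> r" "r < 1" "h r < c + e" using hL by blast
      have "\<forall>z\<in>annulus r. cmod (germ f z) \<le> c + e"
        using cSUP_upper[OF _ bdd[OF r(1)]] r(3) unfolding h_def by fastforce
      then show "eventually (\<lambda>z. cmod (germ f z) \<le> c + e) bdry"
        unfolding eventually_bdry using r r0 by auto
    qed
  next
    assume *: "\<forall>e>0. eventually (\<lambda>z. cmod (germ f z) \<le> c + e) bdry"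
    have "L \<le> c + e" if "e > 0" for e
    proof -
      obtain r where r: "r \<in> {0<..<1}" "\<forall>z\<in>annulus r. cmod (germ f z) \<le> c + e"
        using * \<open>e > 0\<close> unfolding eventually_bdry by blast
      let ?r = "max r r0"
      have "L \<le> h ?r" using r r0 by (intro Lh) auto
      also have "\<dots> \<le> c + e"
        unfolding h_def using r r0 annulus_mono[of r ?r] by (intro cSUP_least ne) auto
      finally show ?thesis .
    qed
    then show "nrm coherent_alg f \<le> c" unfolding nrm by (rule field_le_epsilon)
  qed
qed

lemma null_ideal_iff:
  "f \<in> null_ideal \<longleftrightarrow> f \<in> carrier coherent_alg \<and> (germ f \<longlongrightarrow> 0) bdry"
proof -
  have "nrm coherent_alg f = 0 \<longleftrightarrow> (germ f \<longlongrightarrow> 0) bdry" if f: "f \<in> carrier coherent_alg"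
  proof -
    have "nrm coherent_alg f = 0 \<longleftrightarrow> nrm coherent_alg f \<le> 0"
      using nrm_coherent_nonneg[OF f] by auto
    also have "\<dots> \<longleftrightarrow> (\<forall>e>0. eventually (\<lambda>z. cmod (germ f z) \<le> e) bdry)"
      unfolding nrm_coherent_le_iff[OF f] by simp
    also have "\<dots> \<longleftrightarrow> (\<forall>e>0. eventually (\<lambda>z. cmod (germ f z) < e) bdry)"
    proof safe
      fix e :: real assume "\<forall>e>0. eventually (\<lambda>z. cmod (germ f z) \<le> e) bdry" "0 < e"
      then have "eventually (\<lambda>z. cmod (germ f z) \<le> e / 2) bdry"
        using half_gt_zero by blast
      then show "eventually (\<lambda>z. cmod (germ f z) < e) bdry"
        by eventually_elim (use \<open>0 < e\<close> in auto)
    next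
      fix e :: real assume "\<forall>e>0. eventually (\<lambda>z. cmod (germ f z) < e) bdry" "0 < e"
      then have "eventually (\<lambda>z. cmod (germ f z) < e) bdry" by blast
      then show "eventually (\<lambda>z. cmod (germ f z) \<le> e) bdry"
        by eventually_elim simp
    qed
    also have "\<dots> \<longleftrightarrow> (germ f \<longlongrightarrow> 0) bdry" by (simp add: tendsto_iff)
    finally show ?thesis .
  qed
  then show ?thesis by (auto simp: null_ideal_def)
qed

lemma tendsto_bdry_cong:
  assumes "\<And>z. 1/2 < cmod z \<Longrightarrow> cmod z < 1 \<Longrightarrow> F z = G z"
  shows "(F \<longlongrightarrow> l) bdry \<longleftrightarrow> (G \<longlongrightarrow> l) bdry"
  by (rule tendsto_cong, rule eventually_mono[OF eventually_bdry_ball]) (use assms in auto)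

lemma Bfun_mult_tendsto_zero:
  fixes f g :: "complex \<Rightarrow> complex"
  assumes "Bfun f F" "(g \<longlongrightarrow> 0) F"
  shows "((\<lambda>z. f z * g z) \<longlongrightarrow> 0) F"
  using bounded_bilinear.Bfun_prod_Zfun[OF bounded_bilinear_mult assms(1)] assms(2)
  by (simp add: tendsto_Zfun_iff)

lemma coherent_uminus:
  assumes "f \<in> carrier coherent_alg"
  shows "\<ominus>\<^bsub>coherent_alg\<^esub> f = (-1) \<odot>\<^bsub>coherent_alg\<^esub> f"
proof -
  interpret A: cring coherent_alg by (rule coherent_cring)
  show ?thesis
    using coherent_neg[OF assms] assms coherent_ops_closed(3)
    by (intro A.minus_equality) auto
qed

lemma null_ideal_ideal: "ideal null_ideal coherent_alg"
proof -
  interpret A: cring coherent_alg by (rule coherent_cring)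
  show ?thesis
  proof (rule idealI)
    show "ring coherent_alg" by (rule A.ring_axioms)
    show "subgroup null_ideal (add_monoid coherent_alg)"
    proof (rule A.add.subgroupI)
      have "(germ \<zero>\<^bsub>coherent_alg\<^esub> \<longlongrightarrow> 0) bdry"
        using tendsto_bdry_cong[of "germ \<zero>\<^bsub>coherent_alg\<^esub>" "\<lambda>z. 0"] germ_simps(6) by simp
      then show "null_ideal \<noteq> {}"
        using null_ideal_iff coherent_zero_one_closed by blast
    next
      fix a assume a: "a \<in> null_ideal"
      have "(germ (-1 \<odot>\<^bsub>coherent_alg\<^esub> a) \<longlongrightarrow> 0) bdry \<longleftrightarrow> ((\<lambda>z. -1 * germ a z) \<longlongrightarrow> 0) bdry"
        by (rule tendsto_bdry_cong) (simp only: germ_simps)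
      moreover have "((\<lambda>z. -1 * germ a z) \<longlongrightarrow> 0) bdry"
        by (rule tendsto_mult_right_zero) (use a null_ideal_iff in auto)
      ultimately show "\<ominus>\<^bsub>coherent_alg\<^esub> a \<in> null_ideal"
        using a coherent_uminus coherent_ops_closed by (simp add: null_ideal_iff)
    next
      fix a b assume a: "a \<in> null_ideal" and b: "b \<in> null_ideal"
      have "(germ (a \<oplus>\<^bsub>coherent_alg\<^esub> b) \<longlongrightarrow> 0) bdry \<longleftrightarrow> ((\<lambda>z. germ a z + germ b z) \<longlongrightarrow> 0) bdry"
        by (rule tendsto_bdry_cong) (simp only: germ_simps)
      moreover have "((\<lambda>z. germ a z + germ b z) \<longlongrightarrow> 0) bdry"
        by (rule tendsto_add_zero) (use a b null_ideal_iff in auto)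
      ultimately show "a \<oplus>\<^bsub>coherent_alg\<^esub> b \<in> null_ideal"
        using a b coherent_ops_closed by (simp add: null_ideal_iff)
    qed (auto simp: null_ideal_iff)
    fix a x assume a: "a \<in> null_ideal" and x: "x \<in> carrier coherent_alg"
    have "(germ (x \<otimes>\<^bsub>coherent_alg\<^esub> a) \<longlongrightarrow> 0) bdry \<longleftrightarrow> ((\<lambda>z. germ x z * germ a z) \<longlongrightarrow> 0) bdry"
      by (rule tendsto_bdry_cong) (simp only: germ_simps)
    moreover have "((\<lambda>z. germ x z * germ a z) \<longlongrightarrow> 0) bdry"
      by (rule Bfun_mult_tendsto_zero) (use a x null_ideal_iff Bfun_germ in auto)
    ultimately show "x \<otimes>\<^bsub>coherent_alg\<^esub> a \<in> null_ideal"
      using a x coherent_ops_closed by (simp add: null_ideal_iff)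
    moreover have "a \<otimes>\<^bsub>coherent_alg\<^esub> x = x \<otimes>\<^bsub>coherent_alg\<^esub> a"
      using a x by (intro A.m_comm) (auto simp: null_ideal_iff)
    ultimately show "a \<otimes>\<^bsub>coherent_alg\<^esub> x \<in> null_ideal" by simp
  qed
qed

section \<open>Operations on cosets\<close>

lemma mem_coset_iff:
  assumes f: "f \<in> carrier coherent_alg"
  shows "h \<in> coset f \<longleftrightarrow>
    h \<in> carrier coherent_alg \<and> ((\<lambda>z. germ h z - germ f z) \<longlongrightarrow> 0) bdry"
proof
  assume "h \<in> coset f"
  then obtain n where n: "n \<in> null_ideal" "h = n \<oplus>\<^bsub>coherent_alg\<^esub> f"
    unfolding a_r_coset_def' by blast
  then have "h \<in> carrier coherent_alg"
    using f coherent_ops_closed(2) by (simp add: null_ideal_iff)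
  moreover have "((\<lambda>z. germ h z - germ f z) \<longlongrightarrow> 0) bdry \<longleftrightarrow> (germ n \<longlongrightarrow> 0) bdry"
    by (rule tendsto_bdry_cong) (simp add: n germ_simps)
  ultimately show "h \<in> carrier coherent_alg \<and> ((\<lambda>z. germ h z - germ f z) \<longlongrightarrow> 0) bdry"
    using n by (simp add: null_ideal_iff)
next
  assume h: "h \<in> carrier coherent_alg \<and> ((\<lambda>z. germ h z - germ f z) \<longlongrightarrow> 0) bdry"
  define n where "n = h \<oplus>\<^bsub>coherent_alg\<^esub> ((-1) \<odot>\<^bsub>coherent_alg\<^esub> f)"
  have n: "n \<in> carrier coherent_alg"
    unfolding n_def using f h by (simp add: coherent_intros)
  have "(germ n \<longlongrightarrow> 0) bdry \<longleftrightarrow> ((\<lambda>z. germ h z - germ f z) \<longlongrightarrow> 0) bdry"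
    by (rule tendsto_bdry_cong) (simp add: n_def germ_simps)
  then have "n \<in> null_ideal" using n h by (simp add: null_ideal_iff)
  moreover have "h = n \<oplus>\<^bsub>coherent_alg\<^esub> f"
    by (rule coherent_eqI) (use f h n in \<open>simp_all add: coherent_intros coherent_at n_def\<close>)
  ultimately show "h \<in> coset f" unfolding a_r_coset_def' by blast
qed

lemma coset_eq_iff:
  assumes f: "f \<in> carrier coherent_alg" and g: "g \<in> carrier coherent_alg"
  shows "coset f = coset g \<longleftrightarrow> ((\<lambda>z. germ f z - germ g z) \<longlongrightarrow> 0) bdry"
proof
  assume "coset f = coset g"
  moreover have "f \<in> coset f" using f by (simp add: mem_coset_iff)
  ultimately show "((\<lambda>z. germ f z - germ g z) \<longlongrightarrow> 0) bdry"
    using mem_coset_iff[OF g] by simp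
next
  assume fg: "((\<lambda>z. germ f z - germ g z) \<longlongrightarrow> 0) bdry"
  have "((\<lambda>z. germ h z - germ f z) \<longlongrightarrow> 0) bdry \<longleftrightarrow> ((\<lambda>z. germ h z - germ g z) \<longlongrightarrow> 0) bdry" for h
    using tendsto_add[OF _ fg, of "\<lambda>z. germ h z - germ f z" 0]
      tendsto_diff[OF _ fg, of "\<lambda>z. germ h z - germ g z" 0] by auto
  then show "coset f = coset g"
    using mem_coset_iff[OF f] mem_coset_iff[OF g] by blast
qed

lemma the_elem_image:
  assumes "x \<in> A" "\<And>y. y \<in> A \<Longrightarrow> k y = k x"
  shows "the_elem (k ` A) = k x"
  by (rule the_elem_image_unique) (use assms in blast)+

lemma nrm_coherent_cong:
  assumes f: "f \<in> carrier coherent_alg" and g: "g \<in> carrier coherent_alg"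
    and lim: "((\<lambda>z. germ f z - germ g z) \<longlongrightarrow> 0) bdry"
  shows "nrm coherent_alg f = nrm coherent_alg g"
proof -
  have le: "nrm coherent_alg f \<le> nrm coherent_alg g"
    if f: "f \<in> carrier coherent_alg" and g: "g \<in> carrier coherent_alg"
      and lim: "((\<lambda>z. germ f z - germ g z) \<longlongrightarrow> 0) bdry" for f g
    unfolding nrm_coherent_le_iff[OF f]
  proof (intro allI impI)
    fix e :: real assume "e > 0"
    then have "e / 2 > 0" by simp
    have "eventually (\<lambda>z. cmod (germ g z) \<le> nrm coherent_alg g + e / 2) bdry"
      using nrm_coherent_le_iff[OF g] \<open>e / 2 > 0\<close> by blast
    moreover have "eventually (\<lambda>z. cmod (germ f z - germ g z) < e / 2) bdry"
      using tendstoD[OF lim \<open>e / 2 > 0\<close>] by simp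
    ultimately show "eventually (\<lambda>z. cmod (germ f z) \<le> nrm coherent_alg g + e) bdry"
    proof eventually_elim
      case (elim z)
      then show ?case using norm_triangle_sub[of "germ f z" "germ g z"] by simp
    qed
  qed
  have "((\<lambda>z. germ g z - germ f z) \<longlongrightarrow> 0) bdry"
    using tendsto_minus[OF lim] by simp
  then show ?thesis using le f g lim by (intro antisym) blast+
qed

lemma S_carrier: "carrier S_alg = coset ` carrier coherent_alg"
  by (auto simp: S_alg_def FactRing_def A_RCOSETS_def')

lemma self_mem_coset: "f \<in> carrier coherent_alg \<Longrightarrow> f \<in> coset f"
  by (simp add: mem_coset_iff)

text \<open>Scalar multiplication, norm and involution of the quotient are read off by \<^const>\<open>the_elem\<close>;
  they take a single value on a coset because germs that differ by a null function have the same
  images up to a null function.\<close>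

lemma S_ops:
  assumes f: "f \<in> carrier coherent_alg"
  shows "g \<in> carrier coherent_alg \<Longrightarrow> coset f \<otimes>\<^bsub>S_alg\<^esub> coset g = coset (f \<otimes>\<^bsub>coherent_alg\<^esub> g)"
    and "g \<in> carrier coherent_alg \<Longrightarrow> coset f \<oplus>\<^bsub>S_alg\<^esub> coset g = coset (f \<oplus>\<^bsub>coherent_alg\<^esub> g)"
    and "c \<odot>\<^bsub>S_alg\<^esub> coset f = coset (c \<odot>\<^bsub>coherent_alg\<^esub> f)"
    and "star S_alg (coset f) = coset (star coherent_alg f)"
    and "nrm S_alg (coset f) = nrm coherent_alg f"
proof -
  interpret ideal null_ideal coherent_alg by (rule null_ideal_ideal)
  show "g \<in> carrier coherent_alg \<Longrightarrow> coset f \<otimes>\<^bsub>S_alg\<^esub> coset g = coset (f \<otimes>\<^bsub>coherent_alg\<^esub> g)"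
    using rcoset_mult_add f by (simp add: S_alg_def FactRing_def)
  show "g \<in> carrier coherent_alg \<Longrightarrow> coset f \<oplus>\<^bsub>S_alg\<^esub> coset g = coset (f \<oplus>\<^bsub>coherent_alg\<^esub> g)"
    using a_rcos_sum f by (simp add: S_alg_def FactRing_def)
  have h: "h \<in> carrier coherent_alg" "((\<lambda>z. germ h z - germ f z) \<longlongrightarrow> 0) bdry" if "h \<in> coset f" for h
    using that mem_coset_iff[OF f] by auto
  have sm: "coset (c \<odot>\<^bsub>coherent_alg\<^esub> h) = coset (c \<odot>\<^bsub>coherent_alg\<^esub> f)" if "h \<in> coset f" for h
  proof -
    have "((\<lambda>z. germ (c \<odot>\<^bsub>coherent_alg\<^esub> h) z - germ (c \<odot>\<^bsub>coherent_alg\<^esub> f) z) \<longlongrightarrow> 0) bdry \<longleftrightarrow>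
      ((\<lambda>z. c * (germ h z - germ f z)) \<longlongrightarrow> 0) bdry"
      by (rule tendsto_bdry_cong) (simp add: germ_simps right_diff_distrib)
    then show ?thesis
      using h[OF that] f tendsto_mult_right_zero[OF h(2)[OF that]]
      by (simp add: coset_eq_iff coherent_intros)
  qed
  show "c \<odot>\<^bsub>S_alg\<^esub> coset f = coset (c \<odot>\<^bsub>coherent_alg\<^esub> f)"
    using the_elem_image[OF self_mem_coset[OF f], of "\<lambda>f. coset (c \<odot>\<^bsub>coherent_alg\<^esub> f)"] sm
    by (simp add: S_alg_def)
  have st: "coset (star coherent_alg h) = coset (star coherent_alg f)" if "h \<in> coset f" for h
  proof -
    have "((\<lambda>z. germ (star coherent_alg h) z - germ (star coherent_alg f) z) \<longlongrightarrow> 0) bdry \<longleftrightarrow>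
      ((\<lambda>z. cnj (germ h z - germ f z)) \<longlongrightarrow> 0) bdry"
      by (rule tendsto_bdry_cong) (simp add: germ_simps)
    then show ?thesis
      using h[OF that] f tendsto_cnj[OF h(2)[OF that]]
      by (simp add: coset_eq_iff coherent_intros)
  qed
  show "star S_alg (coset f) = coset (star coherent_alg f)"
    using the_elem_image[OF self_mem_coset[OF f], of "\<lambda>f. coset (star coherent_alg f)"] st
    by (simp add: S_alg_def)
  have "nrm coherent_alg h = nrm coherent_alg f" if "h \<in> coset f" for h
    using h[OF that] f nrm_coherent_cong by blast
  then show "nrm S_alg (coset f) = nrm coherent_alg f"
    using the_elem_image[OF self_mem_coset[OF f], of "nrm coherent_alg"]
    by (simp add: S_alg_def)
qed

section \<open>Representation by functions on the disc\<close>

definition disc_Cb :: "(complex \<Rightarrow> complex) set" where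
  "disc_Cb = {F. continuous_on (ball 0 1) F \<and> bounded (F ` ball 0 1)}"

abbreviation restr :: "(complex \<Rightarrow> complex) \<Rightarrow> real \<Rightarrow> complex \<Rightarrow> complex" where
  "restr F \<equiv> \<lambda>r\<in>{0<..<1}. restrict F (annulus r)"

lemma restr_carrier: "F \<in> disc_Cb \<Longrightarrow> restr F \<in> carrier coherent_alg"
  unfolding disc_Cb_def by (auto intro: coherent_restrict)

lemma disc_Cb_I:
  assumes "continuous_on (ball 0 1) F" "\<And>z. z \<in> ball 0 1 \<Longrightarrow> cmod (F z) \<le> B"
  shows "F \<in> disc_Cb"
  using assms unfolding disc_Cb_def bounded_iff by blast

lemma disc_Cb_E:
  assumes "F \<in> disc_Cb"
  obtains B where "continuous_on (ball 0 1) F" "\<And>z. z \<in> ball 0 1 \<Longrightarrow> cmod (F z) \<le> B" "B > 0"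
proof -
  obtain B where "B > 0" "\<forall>x\<in>F ` ball 0 1. cmod x \<le> B"
    using assms unfolding disc_Cb_def bounded_pos by blast
  then show ?thesis using that assms unfolding disc_Cb_def by blast
qed

lemma disc_Cb_intros:
  assumes "F \<in> disc_Cb"
  shows "G \<in> disc_Cb \<Longrightarrow> (\<lambda>z. F z * G z) \<in> disc_Cb"
    and "G \<in> disc_Cb \<Longrightarrow> (\<lambda>z. F z + G z) \<in> disc_Cb"
    and "G \<in> disc_Cb \<Longrightarrow> (\<lambda>z. F z - G z) \<in> disc_Cb"
    and "(\<lambda>z. - F z) \<in> disc_Cb"
    and "(\<lambda>z. c * F z) \<in> disc_Cb"
    and "(\<lambda>z. cnj (F z)) \<in> disc_Cb"
proof -
  have img: "\<And>\<phi>. continuous_on UNIV \<phi> \<Longrightarrow> G \<in> disc_Cb \<Longrightarrow> (\<lambda>z. \<phi> (F z, G z)) \<in> disc_Cb" for G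
  proof -
    fix \<phi> :: "complex \<times> complex \<Rightarrow> complex"
    assume \<phi>: "continuous_on UNIV \<phi>" and G: "G \<in> disc_Cb"
    have "continuous_on (ball 0 1) (\<lambda>z. (F z, G z))"
      using assms G by (intro continuous_intros) (auto simp: disc_Cb_def)
    then have "continuous_on (ball 0 1) (\<lambda>z. \<phi> (F z, G z))"
      by (rule continuous_on_compose2[OF \<phi>]) auto
    moreover have "bounded ((\<lambda>z. \<phi> (F z, G z)) ` ball 0 1)"
      using assms G by (intro bounded_continuous_image2 \<phi>) (auto simp: disc_Cb_def)
    ultimately show "(\<lambda>z. \<phi> (F z, G z)) \<in> disc_Cb" by (simp add: disc_Cb_def)
  qed
  have cont: "continuous_on UNIV (\<lambda>p::complex \<times> complex. fst p * snd p)"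
    "continuous_on UNIV (\<lambda>p::complex \<times> complex. fst p + snd p)"
    "continuous_on UNIV (\<lambda>p::complex \<times> complex. fst p - snd p)"
    "continuous_on UNIV (\<lambda>p::complex \<times> complex. - fst p)"
    "continuous_on UNIV (\<lambda>p::complex \<times> complex. c * fst p)"
    "continuous_on UNIV (\<lambda>p::complex \<times> complex. cnj (fst p))"
    by (intro continuous_intros)+
  show "G \<in> disc_Cb \<Longrightarrow> (\<lambda>z. F z * G z) \<in> disc_Cb" using img[OF cont(1), of G] by simp
  show "G \<in> disc_Cb \<Longrightarrow> (\<lambda>z. F z + G z) \<in> disc_Cb" using img[OF cont(2), of G] by simp
  show "G \<in> disc_Cb \<Longrightarrow> (\<lambda>z. F z - G z) \<in> disc_Cb" using img[OF cont(3), of G] by simp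
  show "(\<lambda>z. - F z) \<in> disc_Cb" using img[OF cont(4) assms] by simp
  show "(\<lambda>z. c * F z) \<in> disc_Cb" using img[OF cont(5) assms] by simp
  show "(\<lambda>z. cnj (F z)) \<in> disc_Cb" using img[OF cont(6) assms] by simp
qed

lemma disc_Cb_const: "(\<lambda>z. c) \<in> disc_Cb"
  by (rule disc_Cb_I[of _ "cmod c"]) auto

lemma tendsto_cmod_bdry: "(cmod \<longlongrightarrow> 1) bdry"
  unfolding bdry_def
  by (rule filterlim_mono[OF filterlim_filtercomap at_within_le_nhds order_refl])

text \<open>A germ lives on an annulus only. Multiplying it by a radial cut-off that vanishes on a smaller
  disc and tends to 1 at the unit circle makes it continuous on the whole disc without changing its
  class.\<close>

lemma germ_extends:
  assumes f: "f \<in> carrier coherent_alg"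
  obtains F where "F \<in> disc_Cb" "((\<lambda>z. germ f z - F z) \<longlongrightarrow> 0) bdry"
proof -
  obtain r0 where r0: "r0 \<in> {0<..<1}" and cont: "continuous_on (annulus r0) (germ f)"
    and bd: "bounded (germ f ` annulus r0)"
    using coherent_germ[OF f] by metis
  obtain B where B: "B > 0" "\<And>z. z \<in> annulus r0 \<Longrightarrow> cmod (germ f z) \<le> B"
    using bd unfolding bounded_pos by auto
  define r1 where "r1 = (r0 + 1) / 2"
  have r1: "r0 < r1" "r1 < 1" "0 < r1" using r0 by (auto simp: r1_def)
  define \<kappa> where "\<kappa> z = max 0 ((cmod z - r1) / (1 - r1))" for z :: complex
  define F where "F z = germ f z * of_real (\<kappa> z)" for z
  have \<kappa>0: "\<kappa> z = 0" if "cmod z \<le> r1" for z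
    using that r1 by (auto simp: \<kappa>_def max_def field_simps)
  have \<kappa>1: "0 \<le> \<kappa> z" "z \<in> ball 0 1 \<Longrightarrow> \<kappa> z \<le> 1" for z
    using r1 by (auto simp: \<kappa>_def field_simps)
  have "continuous_on (annulus r0 \<union> ball 0 r1) F"
  proof (rule continuous_on_open_Un)
    show "open (annulus r0)"
      unfolding annulus_def by (intro open_Collect_conj open_Collect_less continuous_intros)
    show "continuous_on (annulus r0) F"
      unfolding F_def \<kappa>_def using r1 by (intro continuous_intros cont) auto
    have "continuous_on (ball 0 r1) F \<longleftrightarrow> continuous_on (ball 0 r1) (\<lambda>_::complex. 0 :: complex)"
      by (rule continuous_on_cong) (simp_all add: F_def \<kappa>0)
    then show "continuous_on (ball 0 r1) F" by simp
  qed simp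
  moreover have "annulus r0 \<union> ball 0 r1 = ball 0 1"
    using r1 by (auto simp: annulus_def)
  ultimately have "continuous_on (ball 0 1) F" by simp
  moreover have "cmod (F z) \<le> B" if "z \<in> ball 0 1" for z
  proof (cases "cmod z \<le> r1")
    case True
    then show ?thesis using B by (simp add: F_def \<kappa>0)
  next
    case False
    then have "z \<in> annulus r0" using that r1 by (auto simp: annulus_def)
    then have "cmod (germ f z) * \<kappa> z \<le> B * 1"
      using B \<kappa>1 that by (intro mult_mono) auto
    then show ?thesis using \<kappa>1 by (simp add: F_def norm_mult)
  qed
  ultimately have "F \<in> disc_Cb" by (rule disc_Cb_I)
  moreover have "((\<lambda>z. germ f z - F z) \<longlongrightarrow> 0) bdry"
  proof -
    have "((\<lambda>z. complex_of_real (1 - \<kappa> z)) \<longlongrightarrow> of_real (1 - max 0 ((1 - r1) / (1 - r1)))) bdry"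
      unfolding \<kappa>_def using r1 by (intro tendsto_intros tendsto_cmod_bdry) auto
    then have "((\<lambda>z. complex_of_real (1 - \<kappa> z)) \<longlongrightarrow> 0) bdry" using r1 by simp
    from Bfun_mult_tendsto_zero[OF Bfun_germ[OF f] this] show ?thesis
      by (simp add: F_def algebra_simps)
  qed
  ultimately show ?thesis using that by blast
qed

lemma pi0_restr: "\<pi>\<^sub>0 F = coset (restr F)"
  by (simp add: \<pi>\<^sub>0_def)

lemma mem_pi0_iff:
  assumes F: "F \<in> disc_Cb"
  shows "h \<in> \<pi>\<^sub>0 F \<longleftrightarrow> h \<in> carrier coherent_alg \<and> ((\<lambda>z. germ h z - F z) \<longlongrightarrow> 0) bdry"
proof -
  have "((\<lambda>z. germ h z - germ (restr F) z) \<longlongrightarrow> 0) bdry \<longleftrightarrow> ((\<lambda>z. germ h z - F z) \<longlongrightarrow> 0) bdry"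
    by (rule tendsto_bdry_cong) (simp add: germ_simps)
  then show ?thesis
    unfolding pi0_restr mem_coset_iff[OF restr_carrier[OF F]] by simp
qed

lemma pi0_eq_iff:
  assumes "F \<in> disc_Cb" "G \<in> disc_Cb"
  shows "\<pi>\<^sub>0 F = \<pi>\<^sub>0 G \<longleftrightarrow> ((\<lambda>z. F z - G z) \<longlongrightarrow> 0) bdry"
proof -
  have "((\<lambda>z. germ (restr F) z - germ (restr G) z) \<longlongrightarrow> 0) bdry \<longleftrightarrow> ((\<lambda>z. F z - G z) \<longlongrightarrow> 0) bdry"
    by (rule tendsto_bdry_cong) (simp add: germ_simps)
  then show ?thesis
    using assms by (simp add: pi0_restr coset_eq_iff restr_carrier)
qed

text \<open>So \<^const>\<open>S_alg\<close> is the algebra of bounded continuous functions on the disc modulo those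
  that vanish at the unit circle. Cosets and families can be forgotten from here on.\<close>

lemma S_carrier_pi0: "carrier S_alg = \<pi>\<^sub>0 ` disc_Cb"
proof -
  have "coset f \<in> \<pi>\<^sub>0 ` disc_Cb" if f: "f \<in> carrier coherent_alg" for f
  proof -
    obtain F where F: "F \<in> disc_Cb" "((\<lambda>z. germ f z - F z) \<longlongrightarrow> 0) bdry"
      using germ_extends[OF f] by blast
    then have "f \<in> coset (restr F)" using f by (simp add: mem_pi0_iff flip: pi0_restr)
    then have "((\<lambda>z. germ f z - germ (restr F) z) \<longlongrightarrow> 0) bdry"
      using mem_coset_iff[OF restr_carrier[OF F(1)]] by simp
    then have "coset f = \<pi>\<^sub>0 F"
      using f restr_carrier[OF F(1)] by (simp add: coset_eq_iff pi0_restr)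
    then show ?thesis using F by blast
  qed
  then show ?thesis
    unfolding S_carrier using restr_carrier pi0_restr by fastforce
qed

lemma S_cases:
  assumes "a \<in> carrier S_alg"
  obtains F where "F \<in> disc_Cb" "a = \<pi>\<^sub>0 F"
  using assms unfolding S_carrier_pi0 by blast

lemma pi0_carrier: "F \<in> disc_Cb \<Longrightarrow> \<pi>\<^sub>0 F \<in> carrier S_alg"
  by (simp add: S_carrier_pi0)

lemma pi0_ops:
  assumes F: "F \<in> disc_Cb"
  shows "G \<in> disc_Cb \<Longrightarrow> \<pi>\<^sub>0 F \<otimes>\<^bsub>S_alg\<^esub> \<pi>\<^sub>0 G = \<pi>\<^sub>0 (\<lambda>z. F z * G z)"
    and "G \<in> disc_Cb \<Longrightarrow> \<pi>\<^sub>0 F \<oplus>\<^bsub>S_alg\<^esub> \<pi>\<^sub>0 G = \<pi>\<^sub>0 (\<lambda>z. F z + G z)"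
    and "c \<odot>\<^bsub>S_alg\<^esub> \<pi>\<^sub>0 F = \<pi>\<^sub>0 (\<lambda>z. c * F z)"
    and "star S_alg (\<pi>\<^sub>0 F) = \<pi>\<^sub>0 (\<lambda>z. cnj (F z))"
proof -
  have "restr F \<otimes>\<^bsub>coherent_alg\<^esub> restr G = restr (\<lambda>z. F z * G z)"
    "restr F \<oplus>\<^bsub>coherent_alg\<^esub> restr G = restr (\<lambda>z. F z + G z)" if "G \<in> disc_Cb"
    by (rule coherent_eqI; use F that in \<open>simp add: coherent_intros restr_carrier disc_Cb_intros coherent_at\<close>)+
  then show "G \<in> disc_Cb \<Longrightarrow> \<pi>\<^sub>0 F \<otimes>\<^bsub>S_alg\<^esub> \<pi>\<^sub>0 G = \<pi>\<^sub>0 (\<lambda>z. F z * G z)"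
    "G \<in> disc_Cb \<Longrightarrow> \<pi>\<^sub>0 F \<oplus>\<^bsub>S_alg\<^esub> \<pi>\<^sub>0 G = \<pi>\<^sub>0 (\<lambda>z. F z + G z)"
    using F by (simp_all add: pi0_restr S_ops restr_carrier)
  have "c \<odot>\<^bsub>coherent_alg\<^esub> restr F = restr (\<lambda>z. c * F z)"
    "star coherent_alg (restr F) = restr (\<lambda>z. cnj (F z))"
    by (rule coherent_eqI; use F in \<open>simp add: coherent_intros restr_carrier disc_Cb_intros coherent_at\<close>)+
  then show "c \<odot>\<^bsub>S_alg\<^esub> \<pi>\<^sub>0 F = \<pi>\<^sub>0 (\<lambda>z. c * F z)" "star S_alg (\<pi>\<^sub>0 F) = \<pi>\<^sub>0 (\<lambda>z. cnj (F z))"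
    using F by (simp_all add: pi0_restr S_ops restr_carrier)
qed

lemma pi0_one: "\<one>\<^bsub>S_alg\<^esub> = \<pi>\<^sub>0 (\<lambda>z. 1)"
  by (simp add: S_alg_def FactRing_def pi0_restr coherent_simps)

lemma pi0_zero: "\<zero>\<^bsub>S_alg\<^esub> = \<pi>\<^sub>0 (\<lambda>z. 0)"
proof -
  have "\<zero>\<^bsub>S_alg\<^esub> = null_ideal" by (simp add: S_alg_def FactRing_def)
  also have "\<dots> = \<pi>\<^sub>0 (\<lambda>z. 0)"
    using mem_pi0_iff[OF disc_Cb_const[of 0]] null_ideal_iff by auto
  finally show "\<zero>\<^bsub>S_alg\<^esub> = \<pi>\<^sub>0 (\<lambda>z. 0)" .
qed

lemma nrm_pi0:
  assumes F: "F \<in> disc_Cb"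
  shows nrm_pi0_nonneg: "0 \<le> nrm S_alg (\<pi>\<^sub>0 F)"
    and nrm_pi0_le_iff: "nrm S_alg (\<pi>\<^sub>0 F) \<le> c \<longleftrightarrow> (\<forall>e>0. eventually (\<lambda>z. cmod (F z) \<le> c + e) bdry)"
proof -
  have c: "restr F \<in> carrier coherent_alg" using F by (rule restr_carrier)
  show "0 \<le> nrm S_alg (\<pi>\<^sub>0 F)"
    unfolding pi0_restr S_ops(5)[OF c] by (rule nrm_coherent_nonneg[OF c])
  have "eventually (\<lambda>z. germ (restr F) z = F z) bdry"
    by (rule eventually_mono[OF eventually_bdry_ball]) (simp add: germ_simps)
  then have "eventually (\<lambda>z. cmod (germ (restr F) z) \<le> c + e) bdry \<longleftrightarrow>
    eventually (\<lambda>z. cmod (F z) \<le> c + e) bdry" for e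
    by (intro eventually_subst) (auto elim: eventually_mono)
  then show "nrm S_alg (\<pi>\<^sub>0 F) \<le> c \<longleftrightarrow> (\<forall>e>0. eventually (\<lambda>z. cmod (F z) \<le> c + e) bdry)"
    unfolding pi0_restr S_ops(5)[OF c] nrm_coherent_le_iff[OF c] by simp
qed

lemma nrm_pi0_less:
  assumes "F \<in> disc_Cb" "nrm S_alg (\<pi>\<^sub>0 F) < c"
  shows "eventually (\<lambda>z. cmod (F z) < c) bdry"
proof -
  define e where "e = (c - nrm S_alg (\<pi>\<^sub>0 F)) / 2"
  have "e > 0" using assms by (simp add: e_def)
  then have "eventually (\<lambda>z. cmod (F z) \<le> nrm S_alg (\<pi>\<^sub>0 F) + e) bdry"
    using nrm_pi0_le_iff[OF assms(1)] by blast
  moreover have "nrm S_alg (\<pi>\<^sub>0 F) + e < c"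
    using assms by (simp add: e_def field_simps)
  ultimately show ?thesis by (auto elim: eventually_mono)
qed

lemma nrm_pi0_leI:
  assumes "F \<in> disc_Cb" "eventually (\<lambda>z. cmod (F z) \<le> c) bdry"
  shows "nrm S_alg (\<pi>\<^sub>0 F) \<le> c"
  unfolding nrm_pi0_le_iff[OF assms(1)] using assms(2) by (auto elim!: eventually_mono)

section \<open>The Banach algebra structure\<close>

lemma S_cring: "cring S_alg"
proof (intro cringI abelian_groupI comm_monoidI)
  fix x assume "x \<in> carrier S_alg"
  then obtain F where F: "F \<in> disc_Cb" "x = \<pi>\<^sub>0 F" by (rule S_cases)
  have "\<pi>\<^sub>0 (\<lambda>z. - F z) \<oplus>\<^bsub>S_alg\<^esub> x = \<zero>\<^bsub>S_alg\<^esub>"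
    using F by (simp add: pi0_ops disc_Cb_intros pi0_zero)
  then show "\<exists>y\<in>carrier S_alg. y \<oplus>\<^bsub>S_alg\<^esub> x = \<zero>\<^bsub>S_alg\<^esub>"
    using F pi0_carrier disc_Cb_intros(4) by blast
qed (auto elim!: S_cases
    simp: pi0_ops disc_Cb_intros disc_Cb_const pi0_zero pi0_one pi0_carrier algebra_simps)

lemma S_minus:
  assumes F: "F \<in> disc_Cb" and G: "G \<in> disc_Cb"
  shows "\<pi>\<^sub>0 F \<ominus>\<^bsub>S_alg\<^esub> \<pi>\<^sub>0 G = \<pi>\<^sub>0 (\<lambda>z. F z - G z)"
proof -
  interpret cring S_alg by (rule S_cring)
  have "\<pi>\<^sub>0 (\<lambda>z. - G z) \<oplus>\<^bsub>S_alg\<^esub> \<pi>\<^sub>0 G = \<zero>\<^bsub>S_alg\<^esub>"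
    using G by (simp add: pi0_ops disc_Cb_intros pi0_zero)
  then have "\<ominus>\<^bsub>S_alg\<^esub> \<pi>\<^sub>0 G = \<pi>\<^sub>0 (\<lambda>z. - G z)"
    by (rule minus_equality) (use G in \<open>simp_all add: pi0_carrier disc_Cb_intros\<close>)
  then show ?thesis
    using F G by (simp add: a_minus_def pi0_ops disc_Cb_intros)
qed

lemma norm_dist_pi0:
  "F \<in> disc_Cb \<Longrightarrow> G \<in> disc_Cb \<Longrightarrow> norm_dist S_alg (\<pi>\<^sub>0 F) (\<pi>\<^sub>0 G) = nrm S_alg (\<pi>\<^sub>0 (\<lambda>z. F z - G z))"
  by (simp add: norm_dist_def pi0_carrier S_minus)

lemma nrm_pi0_add:
  assumes F: "F \<in> disc_Cb" and G: "G \<in> disc_Cb"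
  shows "nrm S_alg (\<pi>\<^sub>0 (\<lambda>z. F z + G z)) \<le> nrm S_alg (\<pi>\<^sub>0 F) + nrm S_alg (\<pi>\<^sub>0 G)"
  unfolding nrm_pi0_le_iff[OF disc_Cb_intros(2)[OF F G]]
proof (intro allI impI)
  fix e :: real assume "e > 0"
  then have "\<forall>\<^sub>F z in bdry. cmod (F z) < nrm S_alg (\<pi>\<^sub>0 F) + e / 2"
    "\<forall>\<^sub>F z in bdry. cmod (G z) < nrm S_alg (\<pi>\<^sub>0 G) + e / 2"
    using nrm_pi0_less F G by auto
  then show "\<forall>\<^sub>F z in bdry. cmod (F z + G z) \<le> nrm S_alg (\<pi>\<^sub>0 F) + nrm S_alg (\<pi>\<^sub>0 G) + e"
  proof eventually_elim
    case (elim z)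
    then show ?case using norm_triangle_ineq[of "F z" "G z"] by simp
  qed
qed

lemma nrm_pi0_mult:
  assumes F: "F \<in> disc_Cb" and G: "G \<in> disc_Cb"
  shows "nrm S_alg (\<pi>\<^sub>0 (\<lambda>z. F z * G z)) \<le> nrm S_alg (\<pi>\<^sub>0 F) * nrm S_alg (\<pi>\<^sub>0 G)"
    (is "?l \<le> ?a * ?b")
proof -
  have le: "?l \<le> (?a + e) * (?b + e)" if "e > 0" for e
  proof (rule nrm_pi0_leI[OF disc_Cb_intros(1)[OF F G]])
    have "\<forall>\<^sub>F z in bdry. cmod (F z) < ?a + e" "\<forall>\<^sub>F z in bdry. cmod (G z) < ?b + e"
      using nrm_pi0_less F G that by auto
    then show "\<forall>\<^sub>F z in bdry. cmod (F z * G z) \<le> (?a + e) * (?b + e)"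
    proof eventually_elim
      case (elim z)
      have "0 \<le> cmod (F z)" by simp
      then have "0 \<le> ?a + e" using elim by linarith
      then show ?case using elim unfolding norm_mult by (intro mult_mono) auto
    qed
  qed
  have "((\<lambda>e. (?a + e) * (?b + e)) \<longlongrightarrow> (?a + 0) * (?b + 0)) (at_right 0)"
    by (intro tendsto_intros)
  moreover have "\<forall>\<^sub>F e in at_right 0. ?l \<le> (?a + e) * (?b + e)"
    using le unfolding eventually_at_right_field by (intro exI[of _ 1]) auto
  ultimately have "?l \<le> (?a + 0) * (?b + 0)"
    by (intro tendsto_lowerbound) auto
  then show ?thesis by simp
qed

lemma nrm_pi0_smult_le:
  assumes F: "F \<in> disc_Cb"
  shows "nrm S_alg (\<pi>\<^sub>0 (\<lambda>z. c * F z)) \<le> cmod c * nrm S_alg (\<pi>\<^sub>0 F)"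
proof -
  have "nrm S_alg (\<pi>\<^sub>0 (\<lambda>z. c)) \<le> cmod c"
    by (rule nrm_pi0_leI) (simp_all add: disc_Cb_const)
  then have "nrm S_alg (\<pi>\<^sub>0 (\<lambda>z. c)) * nrm S_alg (\<pi>\<^sub>0 F) \<le> cmod c * nrm S_alg (\<pi>\<^sub>0 F)"
    by (rule mult_right_mono) (rule nrm_pi0_nonneg[OF F])
  with nrm_pi0_mult[OF disc_Cb_const[of c] F] show ?thesis by linarith
qed

lemma nrm_pi0_smult:
  assumes F: "F \<in> disc_Cb"
  shows "nrm S_alg (\<pi>\<^sub>0 (\<lambda>z. c * F z)) = cmod c * nrm S_alg (\<pi>\<^sub>0 F)"
proof (rule antisym[OF nrm_pi0_smult_le[OF F]])
  show "cmod c * nrm S_alg (\<pi>\<^sub>0 F) \<le> nrm S_alg (\<pi>\<^sub>0 (\<lambda>z. c * F z))"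
  proof (cases "c = 0")
    case True
    then show ?thesis using nrm_pi0_nonneg[OF disc_Cb_const[of 0]] by simp
  next
    case False
    then have "(\<lambda>z. inverse c * (c * F z)) = F" by (auto simp: field_simps)
    then have "nrm S_alg (\<pi>\<^sub>0 F) \<le> inverse (cmod c) * nrm S_alg (\<pi>\<^sub>0 (\<lambda>z. c * F z))"
      using nrm_pi0_smult_le[OF disc_Cb_intros(5)[OF F, of c], of "inverse c"] by (simp add: norm_inverse)
    then show ?thesis using False by (simp add: field_simps)
  qed
qed

lemma nrm_pi0_eq_0:
  assumes F: "F \<in> disc_Cb"
  shows "nrm S_alg (\<pi>\<^sub>0 F) = 0 \<longleftrightarrow> \<pi>\<^sub>0 F = \<zero>\<^bsub>S_alg\<^esub>"
proof -
  have "\<pi>\<^sub>0 F = \<zero>\<^bsub>S_alg\<^esub> \<longleftrightarrow> (F \<longlongrightarrow> 0) bdry"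
    using pi0_eq_iff[OF F disc_Cb_const[of 0]] pi0_zero by simp
  also have "\<dots> \<longleftrightarrow> nrm S_alg (\<pi>\<^sub>0 F) = 0"
  proof
    assume "(F \<longlongrightarrow> 0) bdry"
    then have "\<forall>e>0. \<forall>\<^sub>F z in bdry. cmod (F z) \<le> 0 + e"
      unfolding tendsto_iff by (auto elim!: eventually_mono)
    then have "nrm S_alg (\<pi>\<^sub>0 F) \<le> 0" using nrm_pi0_le_iff[OF F] by blast
    then show "nrm S_alg (\<pi>\<^sub>0 F) = 0" using nrm_pi0_nonneg[OF F] by simp
  next
    assume "nrm S_alg (\<pi>\<^sub>0 F) = 0"
    then show "(F \<longlongrightarrow> 0) bdry"
      unfolding tendsto_iff using nrm_pi0_less[OF F] by simp
  qed
  finally show ?thesis by blast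
qed

lemma S_metric: "Metric_space (carrier S_alg) (norm_dist S_alg)"
proof
  show "0 \<le> norm_dist S_alg x y" for x y
  proof (cases "x \<in> carrier S_alg \<and> y \<in> carrier S_alg")
    case True
    then obtain F G where "F \<in> disc_Cb" "x = \<pi>\<^sub>0 F" "G \<in> disc_Cb" "y = \<pi>\<^sub>0 G" by (metis S_cases)
    then show ?thesis by (simp add: norm_dist_pi0 nrm_pi0_nonneg disc_Cb_intros)
  qed (auto simp: norm_dist_def)
  show "norm_dist S_alg x y = norm_dist S_alg y x" for x y
  proof (cases "x \<in> carrier S_alg \<and> y \<in> carrier S_alg")
    case True
    then obtain F G where FG: "F \<in> disc_Cb" "x = \<pi>\<^sub>0 F" "G \<in> disc_Cb" "y = \<pi>\<^sub>0 G" by (metis S_cases)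
    have "nrm S_alg (\<pi>\<^sub>0 (\<lambda>z. (-1) * (F z - G z))) = nrm S_alg (\<pi>\<^sub>0 (\<lambda>z. F z - G z))"
      using nrm_pi0_smult[OF disc_Cb_intros(3)[OF FG(1,3)], of "-1"] by simp
    then show ?thesis using FG by (simp add: norm_dist_pi0)
  qed (auto simp: norm_dist_def)
next
  fix x y assume "x \<in> carrier S_alg" "y \<in> carrier S_alg"
  then obtain F G where FG: "F \<in> disc_Cb" "x = \<pi>\<^sub>0 F" "G \<in> disc_Cb" "y = \<pi>\<^sub>0 G" by (metis S_cases)
  have "norm_dist S_alg x y = 0 \<longleftrightarrow> \<pi>\<^sub>0 (\<lambda>z. F z - G z) = \<pi>\<^sub>0 (\<lambda>z. 0)"
    using FG nrm_pi0_eq_0[OF disc_Cb_intros(3)] pi0_zero by (simp add: norm_dist_pi0)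
  also have "\<dots> \<longleftrightarrow> ((\<lambda>z. F z - G z - 0) \<longlongrightarrow> 0) bdry"
    using FG by (intro pi0_eq_iff disc_Cb_intros disc_Cb_const)
  also have "\<dots> \<longleftrightarrow> x = y" using FG pi0_eq_iff[OF FG(1,3)] by simp
  finally show "norm_dist S_alg x y = 0 \<longleftrightarrow> x = y" .
next
  fix x y z assume "x \<in> carrier S_alg" "y \<in> carrier S_alg" "z \<in> carrier S_alg"
  then obtain F G H where FGH: "F \<in> disc_Cb" "x = \<pi>\<^sub>0 F" "G \<in> disc_Cb" "y = \<pi>\<^sub>0 G" "H \<in> disc_Cb" "z = \<pi>\<^sub>0 H"
    by (metis S_cases)
  then show "norm_dist S_alg x z \<le> norm_dist S_alg x y + norm_dist S_alg y z"
    using nrm_pi0_add[OF disc_Cb_intros(3)[OF FGH(1,3)] disc_Cb_intros(3)[OF FGH(3,5)]]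
    by (simp add: norm_dist_pi0)
qed

text \<open>Cutting the values of \<open>F\<close> off at modulus \<open>c\<close> changes nothing near the unit circle, where
  they are already smaller. This turns a bound on the limit superior into a uniform bound, as needed
  to sum representatives.\<close>

lemma truncated_representative:
  assumes F: "F \<in> disc_Cb" and "nrm S_alg (\<pi>\<^sub>0 F) < c"
  obtains G where "G \<in> disc_Cb" "\<pi>\<^sub>0 G = \<pi>\<^sub>0 F" "\<And>z. cmod (G z) \<le> c"
proof -
  have "c > 0" using assms nrm_pi0_nonneg[OF F] by simp
  define m where "m z = max c (cmod (F z))" for z
  define G where "G z = F z * of_real (c / m z)" for z
  have m: "m z > 0" "cmod (F z) \<le> m z" "m z \<noteq> 0" for z
    using \<open>c > 0\<close> by (auto simp: m_def max_def)
  have "continuous_on (ball 0 1) m"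
    unfolding m_def using F by (intro continuous_intros) (auto simp: disc_Cb_def)
  then have cont: "continuous_on (ball 0 1) G"
    unfolding G_def using F m(3) by (intro continuous_intros) (auto simp: disc_Cb_def)
  have le: "cmod (G z) \<le> c" for z
  proof -
    have "cmod (G z) = cmod (F z) * \<bar>c / m z\<bar>"
      unfolding G_def norm_mult norm_of_real ..
    also have "\<bar>c / m z\<bar> = c / m z"
      using m(1)[of z] \<open>c > 0\<close> by (intro abs_of_pos divide_pos_pos)
    also have "cmod (F z) * (c / m z) \<le> m z * (c / m z)"
      using m[of z] \<open>c > 0\<close> by (intro mult_right_mono) auto
    also have "\<dots> = c" using m(3)[of z] by simp
    finally show ?thesis .
  qed
  have disc_Cb: "G \<in> disc_Cb" by (rule disc_Cb_I[OF cont le])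
  have "\<forall>\<^sub>F z in bdry. G z - F z = 0"
    using nrm_pi0_less[OF assms]
  proof eventually_elim
    case (elim z)
    then have "m z = c" by (simp add: m_def)
    then show ?case using \<open>c > 0\<close> by (simp add: G_def)
  qed
  then have "((\<lambda>z. G z - F z) \<longlongrightarrow> 0) bdry" by (rule tendsto_eventually)
  then have "\<pi>\<^sub>0 G = \<pi>\<^sub>0 F"
    by (simp only: pi0_eq_iff[OF disc_Cb F])
  then show ?thesis by (rule that[OF disc_Cb _ le])
qed

text \<open>A subsequence with geometrically decreasing distances suffices. Its increments have
  representatives with geometrically decreasing uniform bounds, so that their series converges
  uniformly on the disc.\<close>

lemma S_complete: "Metric_space.mcomplete (carrier S_alg) (norm_dist S_alg)"
proof -
  interpret Metric_space "carrier S_alg" "norm_dist S_alg" by (rule S_metric)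
  show ?thesis
    unfolding mcomplete_def
  proof (intro allI impI)
    fix \<sigma> assume \<sigma>: "MCauchy \<sigma>"
    then have "\<forall>n. \<exists>N. \<forall>m m'. N \<le> m \<longrightarrow> N \<le> m' \<longrightarrow> norm_dist S_alg (\<sigma> m) (\<sigma> m') < (1/2) ^ n"
      unfolding MCauchy_def by simp
    then obtain N where N: "\<And>n m m'. N n \<le> m \<Longrightarrow> N n \<le> m' \<Longrightarrow> norm_dist S_alg (\<sigma> m) (\<sigma> m') < (1/2) ^ n"
      by metis
    \<comment> \<open>the summand \<open>n\<close> makes \<open>r\<close> strictly increasing even where \<open>N\<close> vanishes\<close>
    define r where "r n = n + (\<Sum>k\<le>n. N k)" for n
    have r: "strict_mono r" by (rule strict_monoI_Suc) (simp add: r_def)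
    have rN: "N n \<le> r n" for n
      unfolding r_def using member_le_sum[of n "{..n}" N] by simp
    have rS: "N n \<le> r (Suc n)" for n
      using rN[of n] strict_monoD[OF r, of n "Suc n"] by simp
    have "\<forall>n. \<exists>H. H \<in> disc_Cb \<and> \<sigma> n = \<pi>\<^sub>0 H"
      using \<sigma> S_cases unfolding MCauchy_def by (metis rangeI subsetD)
    then obtain H where H: "\<And>n. H n \<in> disc_Cb" "\<And>n. \<sigma> n = \<pi>\<^sub>0 (H n)" by metis
    have "\<exists>D. D \<in> disc_Cb \<and> \<pi>\<^sub>0 D = \<pi>\<^sub>0 (\<lambda>z. H (r (Suc n)) z - H (r n) z) \<and> (\<forall>z. cmod (D z) \<le> (1/2) ^ n)" for n
    proof -
      have "nrm S_alg (\<pi>\<^sub>0 (\<lambda>z. H (r (Suc n)) z - H (r n) z)) < (1/2) ^ n"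
        using N[OF rS[of n] rN[of n]] H by (simp add: norm_dist_pi0)
      from truncated_representative[OF disc_Cb_intros(3)[OF H(1) H(1)] this] show ?thesis by metis
    qed
    then obtain D where D: "\<And>n. D n \<in> disc_Cb" "\<And>n z. cmod (D n z) \<le> (1/2) ^ n"
      "\<And>n. \<pi>\<^sub>0 (D n) = \<pi>\<^sub>0 (\<lambda>z. H (r (Suc n)) z - H (r n) z)"
      by metis
    define P where "P n z = H (r 0) z + (\<Sum>k<n. D k z)" for n z
    have P: "P n \<in> disc_Cb \<and> \<pi>\<^sub>0 (P n) = \<sigma> (r n)" for n
    proof (induction n)
      case 0
      have "P 0 = H (r 0)" by (simp add: P_def fun_eq_iff)
      then show ?case using H by simp
    next
      case (Suc n)
      have PS: "P (Suc n) = (\<lambda>z. P n z + D n z)" by (simp add: P_def fun_eq_iff)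
      then have "P (Suc n) \<in> disc_Cb" using Suc D disc_Cb_intros(2) by simp
      have "\<pi>\<^sub>0 (P (Suc n)) = \<pi>\<^sub>0 (P n) \<oplus>\<^bsub>S_alg\<^esub> \<pi>\<^sub>0 (D n)"
        unfolding PS by (rule pi0_ops(2)[symmetric]) (use Suc D(1) in auto)
      also have "\<dots> = \<pi>\<^sub>0 (H (r n)) \<oplus>\<^bsub>S_alg\<^esub> \<pi>\<^sub>0 (\<lambda>z. H (r (Suc n)) z - H (r n) z)"
        using Suc D(3) H by simp
      also have "\<dots> = \<sigma> (r (Suc n))"
        using H by (simp add: pi0_ops disc_Cb_intros)
      finally show ?case using \<open>P (Suc n) \<in> disc_Cb\<close> by simp
    qed
    have summable: "summable (\<lambda>k. D k z)" for z
      by (rule summable_comparison_test'[of "\<lambda>k. (1/2) ^ k" 0]) (use D(2) in \<open>auto simp: summable_geometric\<close>)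
    define F where "F z = H (r 0) z + (\<Sum>k. D k z)" for z
    have FP: "cmod (F z - P n z) \<le> 2 * (1/2) ^ n" for n z
    proof -
      have "F z - P n z = (\<Sum>k. D (k + n) z)"
        using suminf_minus_initial_segment[OF summable[of z], of n] by (simp add: F_def P_def)
      also have "cmod \<dots> \<le> (\<Sum>k. (1/2) ^ (k + n))"
      proof (rule norm_suminf_le)
        show "summable (\<lambda>k. (1/2) ^ (k + n) :: real)"
          unfolding power_add by (intro summable_mult2 summable_geometric) simp
      qed (rule D(2))
      also have "\<dots> = 2 * (1/2) ^ n"
        using suminf_mult2[OF summable_geometric[of "1/2::real"], of "(1/2) ^ n"]
        by (simp add: power_add suminf_geometric)
      finally show ?thesis .
    qed
    have "uniform_limit (ball 0 1) P F sequentially"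
    proof (rule uniform_limitI)
      fix e :: real assume "e > 0"
      have "(\<lambda>n. 2 * (1/2) ^ n :: real) \<longlonglongrightarrow> 2 * 0"
        by (intro tendsto_intros LIMSEQ_realpow_zero) auto
      then have "\<forall>\<^sub>F n in sequentially. 2 * (1/2) ^ n < e"
        using order_tendstoD(2)[of "\<lambda>n. 2 * (1/2) ^ n :: real" 0] \<open>e > 0\<close> by simp
      then show "\<forall>\<^sub>F n in sequentially. \<forall>x\<in>ball 0 1. dist (P n x) (F x) < e"
      proof eventually_elim
        case (elim n)
        show ?case
        proof
          fix x :: complex
          show "dist (P n x) (F x) < e"
            using FP[of x n] elim by (simp add: dist_norm norm_minus_commute)
        qed
      qed
    qed
    then have "continuous_on (ball 0 1) F"
      by (rule uniform_limit_theorem[rotated]) (use P in \<open>auto simp: disc_Cb_def\<close>)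
    moreover obtain B where B: "\<And>z. z \<in> ball 0 1 \<Longrightarrow> cmod (P 0 z) \<le> B"
      using disc_Cb_E[of "P 0"] P[of 0] by metis
    have "cmod (F z) \<le> B + 2" if "z \<in> ball 0 1" for z
      using FP[of z 0] B[OF that] norm_triangle_sub[of "F z" "P 0 z"] by simp
    ultimately have F: "F \<in> disc_Cb" by (rule disc_Cb_I)
    have dist: "norm_dist S_alg (\<sigma> (r n)) (\<pi>\<^sub>0 F) \<le> 2 * (1/2) ^ n" for n
    proof -
      have "nrm S_alg (\<pi>\<^sub>0 (\<lambda>z. P n z - F z)) \<le> 2 * (1/2) ^ n"
        using P[of n] F FP by (intro nrm_pi0_leI disc_Cb_intros) (auto simp: norm_minus_commute)
      then show ?thesis using P[of n] F norm_dist_pi0[of "P n" F] by simp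
    qed
    have "(\<lambda>n. norm_dist S_alg ((\<sigma> \<circ> r) n) (\<pi>\<^sub>0 F)) \<longlonglongrightarrow> 0"
    proof (rule tendsto_sandwich[of "\<lambda>_. 0" _ _ "\<lambda>n. 2 * (1/2) ^ n"])
      have "(\<lambda>n. 2 * (1/2) ^ n :: real) \<longlonglongrightarrow> 2 * 0"
        by (intro tendsto_intros LIMSEQ_realpow_zero) auto
      then show "(\<lambda>n. 2 * (1/2) ^ n :: real) \<longlonglongrightarrow> 0" by simp
    qed (use dist nonneg in \<open>simp_all\<close>)
    moreover have "\<sigma> k \<in> carrier S_alg" for k
      using H by (simp add: pi0_carrier)
    ultimately have "limitin mtopology (\<sigma> \<circ> r) (\<pi>\<^sub>0 F) sequentially"
      using F by (simp add: limitin_metric_dist_null pi0_carrier)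
    then show "\<exists>x. limitin mtopology \<sigma> x sequentially"
      using MCauchy_convergent_subsequence[OF \<sigma> r] by blast
  qed
qed

lemma type_algebra_simps [simp]:
  "carrier (ring_of_type_algebra :: complex ring) = UNIV"
  "x \<oplus>\<^bsub>(ring_of_type_algebra :: complex ring)\<^esub> y = x + y"
  "x \<otimes>\<^bsub>(ring_of_type_algebra :: complex ring)\<^esub> y = x * y"
  "\<one>\<^bsub>(ring_of_type_algebra :: complex ring)\<^esub> = 1"
  by (simp_all add: ring_of_type_algebra_def)

lemma S_algebra: "Module.algebra (ring_of_type_algebra :: complex ring) S_alg"
  by (rule algebraI)
    (auto elim!: S_cases intro: cring_from_type_algebra S_cring
        simp: pi0_ops disc_Cb_intros pi0_carrier algebra_simps)

lemma S_banach: "unital_commutative_banach_algebra S_alg"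
proof -
  have nrm0: "nrm S_alg \<zero>\<^bsub>S_alg\<^esub> = 0"
    using nrm_pi0_eq_0[OF disc_Cb_const[of 0]] by (simp add: pi0_zero)
  interpret Module.algebra "ring_of_type_algebra :: complex ring" S_alg by (rule S_algebra)
  show ?thesis
  proof
    have "nrm S_alg (\<pi>\<^sub>0 (\<lambda>z. 1)) \<le> 1"
      by (rule nrm_pi0_leI) (auto simp: disc_Cb_const)
    moreover have "\<not> nrm S_alg (\<pi>\<^sub>0 (\<lambda>z. 1)) < 1"
    proof
      assume "nrm S_alg (\<pi>\<^sub>0 (\<lambda>z. 1)) < 1"
      from nrm_pi0_less[OF disc_Cb_const this] have "\<forall>\<^sub>F z in bdry. False" by simp
      then show False using bdry_neq_bot by (simp add: eventually_False)
    qed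
    ultimately show "nrm S_alg \<one>\<^bsub>S_alg\<^esub> = 1"
      unfolding pi0_one by simp
  qed (auto elim!: S_cases intro: S_complete nrm_pi0_add nrm_pi0_mult
      simp: nrm0 pi0_ops nrm_pi0_nonneg nrm_pi0_eq_0 nrm_pi0_smult)
qed

lemma S_involution: "algebra_involution S_alg"
  by unfold_locales
    (auto elim!: S_cases simp: pi0_ops disc_Cb_intros pi0_carrier mult.commute)

section \<open>Units and semisimplicity\<close>

lemma S_unit_inverse:
  assumes F: "F \<in> disc_Cb" and unit: "\<pi>\<^sub>0 F \<in> Units S_alg"
  obtains G where "G \<in> disc_Cb" "((\<lambda>z. F z * G z - 1) \<longlongrightarrow> 0) bdry"
proof -
  obtain x where "x \<in> carrier S_alg" "\<pi>\<^sub>0 F \<otimes>\<^bsub>S_alg\<^esub> x = \<one>\<^bsub>S_alg\<^esub>"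
    using unit by (auto simp: Units_def)
  then obtain G where G: "G \<in> disc_Cb" "\<pi>\<^sub>0 F \<otimes>\<^bsub>S_alg\<^esub> \<pi>\<^sub>0 G = \<one>\<^bsub>S_alg\<^esub>" by (metis S_cases)
  then have "\<pi>\<^sub>0 (\<lambda>z. F z * G z) = \<pi>\<^sub>0 (\<lambda>z. 1)"
    using F pi0_one by (simp add: pi0_ops)
  then have "((\<lambda>z. F z * G z - 1) \<longlongrightarrow> 0) bdry"
    using pi0_eq_iff[OF disc_Cb_intros(1)[OF F G(1)] disc_Cb_const] by simp
  then show ?thesis using that G by blast
qed

lemma S_unit_bounded_below:
  assumes F: "F \<in> disc_Cb" and unit: "\<pi>\<^sub>0 F \<in> Units S_alg"
  obtains \<delta> where "\<delta> > 0" "\<forall>\<^sub>F z in bdry. \<delta> \<le> cmod (F z)"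
proof -
  obtain G where G: "G \<in> disc_Cb" "((\<lambda>z. F z * G z - 1) \<longlongrightarrow> 0) bdry"
    using S_unit_inverse[OF assms] by blast
  obtain B where B: "B > 0" "\<And>z. z \<in> ball 0 1 \<Longrightarrow> cmod (G z) \<le> B"
    using disc_Cb_E[OF G(1)] by metis
  have "\<forall>\<^sub>F z in bdry. cmod (F z * G z - 1) < 1 / 2"
    using tendstoD[OF G(2), of "1/2"] by simp
  then have "\<forall>\<^sub>F z in bdry. 1 / (2 * B) \<le> cmod (F z)"
    using eventually_bdry_ball
  proof eventually_elim
    case (elim z)
    have "1 / 2 \<le> cmod (F z * G z)"
      using norm_triangle_sub[of 1 "F z * G z"] elim by (simp add: norm_minus_commute)
    also have "\<dots> \<le> cmod (F z) * B"
      unfolding norm_mult using B elim by (intro mult_left_mono) auto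
    finally show ?case using B(1) by (simp add: field_simps)
  qed
  then show ?thesis using that[of "1 / (2 * B)"] B(1) by simp
qed

text \<open>Zorn's lemma on the proper ideals that contain \<open>x\<close>, starting from the principal ideal of \<open>x\<close>.\<close>

lemma (in cring) nonunit_in_maximalideal:
  assumes x: "x \<in> carrier R" and nu: "x \<notin> Units R"
  shows "\<exists>I. maximalideal I R \<and> x \<in> I"
proof -
  define A where "A = {I. ideal I R \<and> x \<in> I \<and> \<one> \<notin> I}"
  have "\<one> \<notin> PIdl x"
  proof
    assume "\<one> \<in> PIdl x"
    then obtain y where "y \<in> carrier R" "\<one> = y \<otimes> x" unfolding cgenideal_def by blast
    then have "x \<in> Units R" using x m_comm unfolding Units_def by force
    then show False using nu by simp
  qed
  then have "PIdl x \<in> A"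
    using x cgenideal_ideal cgenideal_self by (simp add: A_def)
  have "\<exists>M\<in>A. \<forall>J\<in>A. M \<subseteq> J \<longrightarrow> J = M"
  proof (rule subset_Zorn_nonempty)
    show "A \<noteq> {}" using \<open>PIdl x \<in> A\<close> by blast
    fix C assume C: "C \<noteq> {}" "subset.chain A C"
    then have "subset.chain {I. ideal I R} C"
      unfolding subset.chain_def A_def by blast
    then have "ideal (\<Union>C) R" using chain_Union_is_ideal[of C] C by simp
    then show "\<Union>C \<in> A"
      using C unfolding A_def subset.chain_def by blast
  qed
  then obtain M where M: "M \<in> A" "\<And>J. J \<in> A \<Longrightarrow> M \<subseteq> J \<Longrightarrow> J = M" by blast
  have "maximalideal M R"
  proof (rule maximalidealI)
    show "ideal M R" using M by (simp add: A_def)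
    show "carrier R \<noteq> M" using M(1) one_closed by (auto simp: A_def)
    fix J assume J: "ideal J R" "M \<subseteq> J" "J \<subseteq> carrier R"
    show "J = M \<or> J = carrier R"
    proof (cases "\<one> \<in> J")
      case True
      then show ?thesis using ideal.one_imp_carrier[OF J(1)] by simp
    next
      case False
      then have "J \<in> A" using J M(1) by (auto simp: A_def)
      then show ?thesis using M(2) J(2) by blast
    qed
  qed
  then show ?thesis using M(1) by (auto simp: A_def)
qed

text \<open>The easy half of the description of the Jacobson radical: a maximal ideal containing both
  \<open>a\<close> and \<open>\<one> \<ominus> a \<otimes> y\<close> would contain \<open>\<one>\<close>.\<close>

lemma (in cring) one_minus_unit_if_in_all_maximal:
  assumes a: "a \<in> \<Inter> {I. maximalideal I R}" "a \<in> carrier R" and y: "y \<in> carrier R"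
  shows "\<one> \<ominus> a \<otimes> y \<in> Units R"
proof (rule ccontr)
  assume "\<one> \<ominus> a \<otimes> y \<notin> Units R"
  then obtain I where I: "maximalideal I R" "\<one> \<ominus> a \<otimes> y \<in> I"
    using nonunit_in_maximalideal[of "\<one> \<ominus> a \<otimes> y"] a y by auto
  interpret maximalideal I R by (rule I(1))
  have "a \<otimes> y \<in> I" using a I(1) y I_r_closed by blast
  then have "(\<one> \<ominus> a \<otimes> y) \<oplus> a \<otimes> y \<in> I" using I(2) by (rule_tac a_closed)
  moreover have "(\<one> \<ominus> a \<otimes> y) \<oplus> a \<otimes> y = \<one>" using a y by algebra
  ultimately show False using one_imp_carrier I_notcarr by simp
qed

text \<open>The function \<open>cnj F / (max e (cmod F))\<^sup>2\<close> is the bounded continuous substitute for the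
  inverse of \<open>F\<close>, exact wherever \<open>F\<close> is not small.\<close>

lemma partial_inverse:
  assumes F: "F \<in> disc_Cb" and "e > 0"
  obtains Y where "Y \<in> disc_Cb" "\<And>z. e \<le> cmod (F z) \<Longrightarrow> F z * Y z = 1"
proof -
  define m where "m z = max e (cmod (F z))" for z
  define Y where "Y z = cnj (F z) / of_real (m z * m z)" for z
  have m: "m z > 0" "m z \<noteq> 0" "cmod (F z) \<le> m z" "e \<le> m z" for z
    using \<open>e > 0\<close> by (auto simp: m_def max_def)
  have "continuous_on (ball 0 1) m"
    unfolding m_def using F by (intro continuous_intros) (auto simp: disc_Cb_def)
  then have cont: "continuous_on (ball 0 1) Y"
    unfolding Y_def using F m(2) by (intro continuous_intros) (auto simp: disc_Cb_def)
  have le: "cmod (Y z) \<le> 1 / e" for z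
  proof -
    have "cmod (Y z) = cmod (F z) / \<bar>m z * m z\<bar>"
      unfolding Y_def norm_divide norm_of_real complex_mod_cnj ..
    also have "\<bar>m z * m z\<bar> = m z * m z" by simp
    also have "cmod (F z) / (m z * m z) \<le> m z / (m z * m z)"
      using m(3) by (rule divide_right_mono) simp
    also have "\<dots> = 1 / m z" using m(2)[of z] by simp
    also have "\<dots> \<le> 1 / e"
      using \<open>e > 0\<close> m(1,4)[of z] by (simp add: frac_le)
    finally show ?thesis .
  qed
  have "F z * Y z = 1" if "e \<le> cmod (F z)" for z
  proof -
    have "m z = cmod (F z)" using that by (simp add: m_def)
    then have "of_real (m z * m z) = F z * cnj (F z)"
      using complex_norm_square[of "F z"] by (simp add: power2_eq_square)
    moreover have "complex_of_real (m z * m z) \<noteq> 0" using m(2)[of z] by simp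
    ultimately show ?thesis unfolding Y_def times_divide_eq_right by (metis divide_self)
  qed
  then show ?thesis by (rule that[OF disc_Cb_I[OF cont le]])
qed

text \<open>If \<open>F\<close> did not tend to 0 at the unit circle, then for some \<open>e\<close> there would be points arbitrarily
  close to the circle with \<open>e \<le> cmod (F z)\<close>. At these points \<open>1 - F * Y\<close> vanishes for the partial
  inverse \<open>Y\<close>, although it represents a unit and is therefore bounded below near the circle.\<close>

lemma zero_if_in_all_maximal:
  assumes a: "a \<in> \<Inter> {I. maximalideal I S_alg}" "a \<in> carrier S_alg"
  shows "a = \<zero>\<^bsub>S_alg\<^esub>"
proof -
  interpret cring S_alg by (rule S_cring)
  obtain F where F: "F \<in> disc_Cb" "a = \<pi>\<^sub>0 F" using a(2) by (rule S_cases)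
  have "\<forall>\<^sub>F z in bdry. cmod (F z) < e" if "e > 0" for e
  proof -
    obtain Y where Y: "Y \<in> disc_Cb" "\<And>z. e \<le> cmod (F z) \<Longrightarrow> F z * Y z = 1"
      using partial_inverse[OF F(1) \<open>e > 0\<close>] by blast
    have eq: "\<one>\<^bsub>S_alg\<^esub> \<ominus>\<^bsub>S_alg\<^esub> a \<otimes>\<^bsub>S_alg\<^esub> \<pi>\<^sub>0 Y = \<pi>\<^sub>0 (\<lambda>z. 1 - F z * Y z)"
      using F Y(1) by (simp add: pi0_ops pi0_one S_minus disc_Cb_intros disc_Cb_const)
    have unit: "\<pi>\<^sub>0 (\<lambda>z. 1 - F z * Y z) \<in> Units S_alg"
      using one_minus_unit_if_in_all_maximal[OF a pi0_carrier[OF Y(1)]] unfolding eq .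
    obtain \<delta> where \<delta>: "\<delta> > 0" "\<forall>\<^sub>F z in bdry. \<delta> \<le> cmod (1 - F z * Y z)"
      by (rule S_unit_bounded_below[OF disc_Cb_intros(3)[OF disc_Cb_const disc_Cb_intros(1)[OF F(1) Y(1)]] unit])
    from \<delta>(2) show ?thesis
    proof eventually_elim
      case (elim z)
      show ?case
      proof (rule ccontr)
        assume "\<not> cmod (F z) < e"
        then have "F z * Y z = 1" by (intro Y(2)) simp
        then show False using elim \<delta>(1) by simp
      qed
    qed
  qed
  then have "(F \<longlongrightarrow> 0) bdry" by (simp add: tendsto_iff)
  then show ?thesis
    using F pi0_eq_iff[OF F(1) disc_Cb_const[of 0]] by (simp add: pi0_zero)
qed

lemma S_nontrivial: "\<one>\<^bsub>S_alg\<^esub> \<noteq> \<zero>\<^bsub>S_alg\<^esub>"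
proof
  assume "\<one>\<^bsub>S_alg\<^esub> = \<zero>\<^bsub>S_alg\<^esub>"
  then have "((\<lambda>z. 1 :: complex) \<longlongrightarrow> 0) bdry"
    using pi0_eq_iff[OF disc_Cb_const[of 1] disc_Cb_const[of 0]] by (simp add: pi0_one pi0_zero)
  then show False using bdry_neq_bot by (simp add: tendsto_const_iff)
qed

text \<open>The existence of one maximal ideal has to be shown, since an empty intersection would be the whole
  type rather than \<open>{\<zero>}\<close>.\<close>

lemma S_semisimple: "semisimple S_alg"
proof -
  interpret cring S_alg by (rule S_cring)
  have zero: "\<zero>\<^bsub>S_alg\<^esub> \<in> I" if "maximalideal I S_alg" for I
    using additive_subgroup.zero_closed[OF ideal.axioms(1)[OF maximalideal.axioms(1)[OF that]]] .
  have "\<zero>\<^bsub>S_alg\<^esub> \<notin> Units S_alg"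
  proof
    assume "\<zero>\<^bsub>S_alg\<^esub> \<in> Units S_alg"
    then obtain x where "x \<in> carrier S_alg" "\<zero>\<^bsub>S_alg\<^esub> \<otimes>\<^bsub>S_alg\<^esub> x = \<one>\<^bsub>S_alg\<^esub>"
      unfolding Units_def by blast
    then show False using S_nontrivial by simp
  qed
  then obtain I where I: "maximalideal I S_alg"
    using nonunit_in_maximalideal[OF zero_closed] by blast
  then have "I \<subseteq> carrier S_alg"
    using additive_subgroup.a_subset ideal.axioms(1) maximalideal.axioms(1) by blast
  then have "a \<in> carrier S_alg" if "a \<in> \<Inter> {I. maximalideal I S_alg}" for a
    using that I by blast
  then show ?thesis
    unfolding semisimple_def using zero zero_if_in_all_maximal by blast
qed

section \<open>Winding numbers along circles\<close>

text \<open>Continuous logarithms of the two paths add up to one of the product.\<close>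

lemma winding_number_mult:
  assumes p: "path p" "0 \<notin> path_image p" and q: "path q" "0 \<notin> path_image q"
  shows "winding_number (\<lambda>t. p t * q t) 0 = winding_number p 0 + winding_number q 0"
proof -
  obtain a where a: "path a" "pathfinish a - pathstart a = 2 * of_real pi * \<i> * winding_number p 0"
    "\<And>t. t \<in> {0..1} \<Longrightarrow> p t = 0 + exp (a t)"
    using winding_number_as_continuous_log[OF p] by blast
  obtain b where b: "path b" "pathfinish b - pathstart b = 2 * of_real pi * \<i> * winding_number q 0"
    "\<And>t. t \<in> {0..1} \<Longrightarrow> q t = 0 + exp (b t)"
    using winding_number_as_continuous_log[OF q] by blast
  define c where "c t = a t + b t" for t
  have c: "path c"
    using a(1) b(1) unfolding path_def c_def by (intro continuous_intros)
  have "winding_number (\<lambda>t. p t * q t) 0 = winding_number (exp \<circ> c) 0"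
    by (rule winding_number_cong) (simp add: a(3) b(3) c_def exp_add)
  also have "\<dots> = (pathfinish c - pathstart c) / (2 * of_real pi * \<i>)"
    by (rule winding_number_compose_exp[OF c])
  also have "pathfinish c - pathstart c =
      (pathfinish a - pathstart a) + (pathfinish b - pathstart b)"
    by (simp add: c_def pathfinish_def pathstart_def)
  also have "\<dots> = 2 * of_real pi * \<i> * (winding_number p 0 + winding_number q 0)"
    by (simp only: a(2) b(2) distrib_left)
  finally show ?thesis by simp
qed

lemma circle_path:
  assumes "continuous_on (sphere 0 \<rho>) F" "0 \<le> \<rho>"
  shows "path (F \<circ> circlepath 0 \<rho>)" "pathfinish (F \<circ> circlepath 0 \<rho>) = pathstart (F \<circ> circlepath 0 \<rho>)"
    "path_image (F \<circ> circlepath 0 \<rho>) = F ` sphere 0 \<rho>"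
proof -
  show "path (F \<circ> circlepath 0 \<rho>)"
    using assms by (intro path_continuous_image) auto
  show "pathfinish (F \<circ> circlepath 0 \<rho>) = pathstart (F \<circ> circlepath 0 \<rho>)"
    by (simp add: pathfinish_compose pathstart_compose)
  show "path_image (F \<circ> circlepath 0 \<rho>) = F ` sphere 0 \<rho>"
    using assms by (simp add: path_image_compose)
qed

lemma circlepath_in_sphere: "0 \<le> \<rho> \<Longrightarrow> t \<in> {0..1} \<Longrightarrow> circlepath 0 \<rho> t \<in> sphere 0 \<rho>"
  by (simp add: circlepath norm_mult)

text \<open>The winding number called \<open>w (F restricted to the circle of radius \<rho>)\<close> in the definition of the index.\<close>

definition circle_wind :: "(complex \<Rightarrow> complex) \<Rightarrow> real \<Rightarrow> int" where
  "circle_wind F \<rho> = wind (\<lambda>\<zeta>. F (of_real \<rho> * \<zeta>))"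

lemma of_int_circle_wind:
  assumes "continuous_on (sphere 0 \<rho>) F" "0 \<le> \<rho>" "\<And>z. z \<in> sphere 0 \<rho> \<Longrightarrow> F z \<noteq> 0"
  shows "of_int (circle_wind F \<rho>) = winding_number (F \<circ> circlepath 0 \<rho>) 0"
proof -
  have eq: "(\<lambda>\<zeta>. F (of_real \<rho> * \<zeta>)) \<circ> circlepath 0 1 = F \<circ> circlepath 0 \<rho>"
    by (auto simp: circlepath)
  have "winding_number (F \<circ> circlepath 0 \<rho>) 0 \<in> \<int>"
    using assms circle_path[OF assms(1,2)] by (intro integer_winding_number) auto
  then obtain k where k: "winding_number (F \<circ> circlepath 0 \<rho>) 0 = of_int k"
    by (auto elim: Ints_cases)
  then have "circle_wind F \<rho> = k"
    unfolding circle_wind_def wind_def eq by (intro the_equality) auto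
  then show ?thesis using k by simp
qed

lemma circle_wind_cong:
  assumes "\<And>z. z \<in> sphere 0 \<rho> \<Longrightarrow> F z = G z" "0 \<le> \<rho>"
  shows "circle_wind F \<rho> = circle_wind G \<rho>"
proof -
  have "(\<lambda>\<zeta>. F (of_real \<rho> * \<zeta>)) \<circ> circlepath 0 1 = (\<lambda>\<zeta>. G (of_real \<rho> * \<zeta>)) \<circ> circlepath 0 1"
    using assms by (auto simp: circlepath fun_eq_iff norm_mult)
  then show ?thesis by (simp add: circle_wind_def wind_def)
qed

text \<open>Two concentric circles in the annulus are homotopic in it by moving along radii.\<close>

lemma circle_wind_radius:
  assumes cont: "continuous_on (annulus r) F" and nz: "\<And>z. z \<in> annulus r \<Longrightarrow> F z \<noteq> 0"
    and "0 \<le> r" "\<rho> \<in> {r<..<1}" "\<rho>' \<in> {r<..<1}"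
  shows "circle_wind F \<rho> = circle_wind F \<rho>'"
proof -
  have sub: "sphere 0 \<rho> \<subseteq> annulus r" "sphere 0 \<rho>' \<subseteq> annulus r"
    using assms by (auto simp: annulus_def)
  have "homotopic_loops (annulus r) (circlepath 0 \<rho>) (circlepath 0 \<rho>')"
  proof (rule homotopic_loops_linear)
    fix t :: real
    assume "t \<in> {0..1}"
    show "closed_segment (circlepath 0 \<rho> t) (circlepath 0 \<rho>' t) \<subseteq> annulus r"
    proof
      fix w assume "w \<in> closed_segment (circlepath 0 \<rho> t) (circlepath 0 \<rho>' t)"
      then obtain u where u: "0 \<le> u" "u \<le> 1"
        "w = (1 - u) *\<^sub>R circlepath 0 \<rho> t + u *\<^sub>R circlepath 0 \<rho>' t"
        unfolding closed_segment_def by auto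
      define s where "s = (1 - u) * \<rho> + u * \<rho>'"
      have s: "s \<in> {r<..<1}"
        unfolding s_def
        using convexD_alt[OF convex_real_interval(8), of \<rho> r 1 \<rho>' u] u(1,2) assms(4,5) by simp
      have "w = of_real s * exp (2 * of_real pi * \<i> * of_real t)"
        by (simp add: u(3) s_def circlepath scaleR_conv_of_real algebra_simps)
      then have "cmod w = s" using s \<open>0 \<le> r\<close> by (simp add: norm_mult)
      then show "w \<in> annulus r" using s by (simp add: annulus_def)
    qed
  qed auto
  then have "homotopic_loops (- {0}) (F \<circ> circlepath 0 \<rho>) (F \<circ> circlepath 0 \<rho>')"
    by (rule homotopic_loops_continuous_image[OF _ cont]) (use nz in auto)
  then have "winding_number (F \<circ> circlepath 0 \<rho>) 0 = winding_number (F \<circ> circlepath 0 \<rho>') 0"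
    by (rule winding_number_homotopic_loops)
  moreover have "of_int (circle_wind F \<rho>) = winding_number (F \<circ> circlepath 0 \<rho>) 0"
    using assms sub continuous_on_subset[OF cont sub(1)] by (intro of_int_circle_wind) auto
  moreover have "of_int (circle_wind F \<rho>') = winding_number (F \<circ> circlepath 0 \<rho>') 0"
    using assms sub continuous_on_subset[OF cont sub(2)] by (intro of_int_circle_wind) auto
  ultimately have "(of_int (circle_wind F \<rho>) :: complex) = of_int (circle_wind F \<rho>')" by simp
  then show ?thesis by simp
qed

text \<open>Rouche's principle in its topological form.\<close>

lemma circle_wind_perturb:
  assumes F: "continuous_on (sphere 0 \<rho>) F" and G: "continuous_on (sphere 0 \<rho>) G" and "0 \<le> \<rho>"
    and less: "\<And>z. z \<in> sphere 0 \<rho> \<Longrightarrow> cmod (G z - F z) < cmod (F z)"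
  shows "circle_wind G \<rho> = circle_wind F \<rho>"
proof -
  have nz: "F z \<noteq> 0" "G z \<noteq> 0" if "z \<in> sphere 0 \<rho>" for z
    using less[OF that] by auto
  have "winding_number (G \<circ> circlepath 0 \<rho>) 0 = winding_number (F \<circ> circlepath 0 \<rho>) 0"
    using circle_path[OF F \<open>0 \<le> \<rho>\<close>] circle_path[OF G \<open>0 \<le> \<rho>\<close>] less circlepath_in_sphere[OF \<open>0 \<le> \<rho>\<close>]
    by (intro winding_number_nearby_loops_eq) auto
  then have "(of_int (circle_wind G \<rho>) :: complex) = of_int (circle_wind F \<rho>)"
    using of_int_circle_wind[OF F \<open>0 \<le> \<rho>\<close>] of_int_circle_wind[OF G \<open>0 \<le> \<rho>\<close>] nz by simp
  then show ?thesis by simp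
qed

lemma circle_wind_mult:
  assumes F: "continuous_on (sphere 0 \<rho>) F" and G: "continuous_on (sphere 0 \<rho>) G" and "0 \<le> \<rho>"
    and nz: "\<And>z. z \<in> sphere 0 \<rho> \<Longrightarrow> F z \<noteq> 0" "\<And>z. z \<in> sphere 0 \<rho> \<Longrightarrow> G z \<noteq> 0"
  shows "circle_wind (\<lambda>z. F z * G z) \<rho> = circle_wind F \<rho> + circle_wind G \<rho>"
proof -
  have "winding_number (\<lambda>t. (F \<circ> circlepath 0 \<rho>) t * (G \<circ> circlepath 0 \<rho>) t) 0 =
    winding_number (F \<circ> circlepath 0 \<rho>) 0 + winding_number (G \<circ> circlepath 0 \<rho>) 0"
  proof (rule winding_number_mult)
    show "0 \<notin> path_image (F \<circ> circlepath 0 \<rho>)" "0 \<notin> path_image (G \<circ> circlepath 0 \<rho>)"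
      using circle_path(3)[OF F \<open>0 \<le> \<rho>\<close>] circle_path(3)[OF G \<open>0 \<le> \<rho>\<close>] nz by fastforce+
  qed (rule circle_path(1)[OF F \<open>0 \<le> \<rho>\<close>] circle_path(1)[OF G \<open>0 \<le> \<rho>\<close>])+
  moreover have "(\<lambda>t. (F \<circ> circlepath 0 \<rho>) t * (G \<circ> circlepath 0 \<rho>) t) = (\<lambda>z. F z * G z) \<circ> circlepath 0 \<rho>"
    by auto
  moreover have "of_int (circle_wind (\<lambda>z. F z * G z) \<rho>) = winding_number ((\<lambda>z. F z * G z) \<circ> circlepath 0 \<rho>) 0"
    using nz by (intro of_int_circle_wind continuous_intros F G \<open>0 \<le> \<rho>\<close>) auto
  ultimately have "(of_int (circle_wind (\<lambda>z. F z * G z) \<rho>) :: complex) = of_int (circle_wind F \<rho> + circle_wind G \<rho>)"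
    using of_int_circle_wind[OF F \<open>0 \<le> \<rho>\<close>] of_int_circle_wind[OF G \<open>0 \<le> \<rho>\<close>] nz by simp
  then show ?thesis by (simp only: of_int_eq_iff)
qed

lemma circle_wind_cnj:
  assumes F: "continuous_on (sphere 0 \<rho>) F" and "0 \<le> \<rho>"
    and nz: "\<And>z. z \<in> sphere 0 \<rho> \<Longrightarrow> F z \<noteq> 0"
  shows "circle_wind (\<lambda>z. cnj (F z)) \<rho> = - circle_wind F \<rho>"
proof -
  have "0 \<notin> path_image (F \<circ> circlepath 0 \<rho>)"
    using circle_path(3)[OF F \<open>0 \<le> \<rho>\<close>] nz by auto
  then have "winding_number (cnj \<circ> (F \<circ> circlepath 0 \<rho>)) 0 = - cnj (winding_number (F \<circ> circlepath 0 \<rho>) 0)"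
    using winding_number_cnj[OF circle_path(1)[OF F \<open>0 \<le> \<rho>\<close>], of 0] by simp
  moreover have "cnj \<circ> (F \<circ> circlepath 0 \<rho>) = (\<lambda>z. cnj (F z)) \<circ> circlepath 0 \<rho>" by auto
  moreover have "of_int (circle_wind (\<lambda>z. cnj (F z)) \<rho>) = winding_number ((\<lambda>z. cnj (F z)) \<circ> circlepath 0 \<rho>) 0"
    using nz by (intro of_int_circle_wind continuous_intros F \<open>0 \<le> \<rho>\<close>) auto
  moreover have "winding_number (F \<circ> circlepath 0 \<rho>) 0 = of_int (circle_wind F \<rho>)"
    using of_int_circle_wind[OF F \<open>0 \<le> \<rho>\<close> nz] by simp
  ultimately have "(of_int (circle_wind (\<lambda>z. cnj (F z)) \<rho>) :: complex) = of_int (- circle_wind F \<rho>)"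
    by simp
  then show ?thesis by (simp only: of_int_eq_iff)
qed

section \<open>The index\<close>

text \<open>The two radii in the definition of \<^const>\<open>has_index\<close> collapse to one, since the members of a
  coherent family eventually are restrictions of its germ.\<close>

definition bdry_index :: "(complex \<Rightarrow> complex) \<Rightarrow> int \<Rightarrow> bool" where
  "bdry_index F k \<longleftrightarrow> (\<forall>\<^sub>F \<rho> in at_left 1. (\<forall>z\<in>sphere 0 \<rho>. F z \<noteq> 0) \<and> circle_wind F \<rho> = k)"

lemma eventually_bdry_sphere:
  assumes "eventually P bdry"
  shows "\<forall>\<^sub>F \<rho> in at_left 1. 0 < \<rho> \<and> \<rho> < 1 \<and> (\<forall>z\<in>sphere 0 \<rho>. P z)"
proof -
  obtain r where r: "r \<in> {0<..<1}" "\<forall>z\<in>annulus r. P z"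
    using assms unfolding eventually_bdry by blast
  show ?thesis
    unfolding eventually_at_left_field
    by (rule exI[of _ r]) (use r in \<open>auto simp: annulus_def\<close>)
qed

lemma bdry_index_unique: "bdry_index F k \<Longrightarrow> bdry_index F l \<Longrightarrow> k = l"
proof -
  assume "bdry_index F k" "bdry_index F l"
  then have "\<forall>\<^sub>F \<rho> in at_left (1::real). k = l"
    unfolding bdry_index_def by eventually_elim auto
  then show ?thesis by simp
qed

lemma bdry_index_exists:
  assumes "r \<in> {0<..<1}" "continuous_on (annulus r) F" "\<And>z. z \<in> annulus r \<Longrightarrow> F z \<noteq> 0"
  shows "\<exists>k. bdry_index F k"
proof -
  define \<rho> where "\<rho> = (r + 1) / 2"
  have "\<rho> \<in> {r<..<1}" using assms(1) by (auto simp: \<rho>_def)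
  then have "(\<forall>z\<in>sphere 0 \<sigma>. F z \<noteq> 0) \<and> circle_wind F \<sigma> = circle_wind F \<rho>" if "\<sigma> \<in> {r<..<1}" for \<sigma>
    using circle_wind_radius[OF assms(2,3) _ that] assms that by (auto simp: annulus_def)
  then have "bdry_index F (circle_wind F \<rho>)"
    unfolding bdry_index_def eventually_at_left_field
    using assms(1) by (intro exI[of _ r]) simp
  then show ?thesis by blast
qed

lemma eventually_continuous_sphere:
  assumes "r < 1" "continuous_on (annulus r) F"
  shows "\<forall>\<^sub>F \<rho> in at_left 1. continuous_on (sphere 0 \<rho>) F"
  unfolding eventually_at_left_field
  using assms continuous_on_subset sphere_subset_annulus by blast

lemma bdry_index_perturb:
  assumes F: "r < 1" "continuous_on (annulus r) F" and G: "r' < 1" "continuous_on (annulus r') G"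
    and "\<forall>\<^sub>F z in bdry. cmod (G z - F z) < cmod (F z)" and "bdry_index F k"
  shows "bdry_index G k"
  using eventually_bdry_sphere[OF assms(5)] eventually_continuous_sphere[OF F]
    eventually_continuous_sphere[OF G] assms(6)
  unfolding bdry_index_def
proof eventually_elim
  case (elim \<rho>)
  then have "circle_wind G \<rho> = circle_wind F \<rho>" by (intro circle_wind_perturb) auto
  moreover have "G z \<noteq> 0" if "z \<in> sphere 0 \<rho>" for z using elim that by force
  ultimately show ?case using elim by simp
qed

lemma bdry_index_mult:
  assumes F: "r < 1" "continuous_on (annulus r) F" and G: "r' < 1" "continuous_on (annulus r') G"
    and "bdry_index F k" "bdry_index G l"
  shows "bdry_index (\<lambda>z. F z * G z) (k + l)"
proof -
  have "\<forall>\<^sub>F \<rho>::real in at_left 1. 0 < \<rho>"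
    unfolding eventually_at_left_field by (intro exI[of _ 0]) auto
  then show ?thesis
    using eventually_continuous_sphere[OF F] eventually_continuous_sphere[OF G] assms(5,6)
    unfolding bdry_index_def
  proof eventually_elim
    case (elim \<rho>)
    then have "circle_wind (\<lambda>z. F z * G z) \<rho> = circle_wind F \<rho> + circle_wind G \<rho>" by (intro circle_wind_mult) auto
    then show ?case using elim by simp
  qed
qed

lemma bdry_index_cnj:
  assumes F: "r < 1" "continuous_on (annulus r) F" and "bdry_index F k"
  shows "bdry_index (\<lambda>z. cnj (F z)) (- k)"
proof -
  have "\<forall>\<^sub>F \<rho>::real in at_left 1. 0 < \<rho>"
    unfolding eventually_at_left_field by (intro exI[of _ 0]) auto
  then show ?thesis
    using eventually_continuous_sphere[OF F] assms(3)
    unfolding bdry_index_def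
  proof eventually_elim
    case (elim \<rho>)
    then have "circle_wind (\<lambda>z. cnj (F z)) \<rho> = - circle_wind F \<rho>" by (intro circle_wind_cnj) auto
    then show ?case using elim by simp
  qed
qed

lemma has_index_iff:
  assumes f: "f \<in> carrier coherent_alg"
  shows "has_index f k \<longleftrightarrow> bdry_index (germ f) k"
proof -
  obtain r0 where r0: "r0 \<in> {0<..<1}"
    and eq: "\<And>r z. r0 \<le> r \<Longrightarrow> r < 1 \<Longrightarrow> z \<in> annulus r \<Longrightarrow> f r z = germ f z"
    using coherent_germ[OF f] by metis
  have same: "((\<forall>z\<in>sphere 0 \<rho>. f r z \<noteq> 0) \<and> wind (\<lambda>\<zeta>. f r (of_real \<rho> * \<zeta>)) = k) \<longleftrightarrow>
    ((\<forall>z\<in>sphere 0 \<rho>. germ f z \<noteq> 0) \<and> circle_wind (germ f) \<rho> = k)"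
    if "r0 \<le> r" "r < \<rho>" "\<rho> < 1" for r \<rho>
  proof -
    have "f r z = germ f z" if "z \<in> sphere 0 \<rho>" for z
      using that \<open>r0 \<le> r\<close> \<open>r < \<rho>\<close> \<open>\<rho> < 1\<close> by (intro eq) (auto simp: annulus_def)
    moreover from this have "circle_wind (f r) \<rho> = circle_wind (germ f) \<rho>"
      using r0 that by (intro circle_wind_cong) auto
    ultimately show ?thesis by (simp add: circle_wind_def)
  qed
  show ?thesis
  proof
    assume "has_index f k"
    then obtain b where b: "b < 1" "\<And>r \<rho>. b < r \<Longrightarrow> r < 1 \<Longrightarrow> \<rho> \<in> {r<..<1} \<Longrightarrow>
      (\<forall>z\<in>sphere 0 \<rho>. f r z \<noteq> 0) \<and> wind (\<lambda>\<zeta>. f r (of_real \<rho> * \<zeta>)) = k"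
      unfolding has_index_def eventually_at_left_field by blast
    define r where "r = (max b r0 + 1) / 2"
    have r: "b < r" "r0 \<le> r" "r < 1" using b(1) r0 by (auto simp: r_def)
    have "(\<forall>z\<in>sphere 0 \<rho>. germ f z \<noteq> 0) \<and> circle_wind (germ f) \<rho> = k" if \<rho>: "r < \<rho>" "\<rho> < 1" for \<rho>
      using same[OF r(2) \<rho>] b(2)[OF r(1,3), of \<rho>] \<rho> by simp
    then show "bdry_index (germ f) k"
      unfolding bdry_index_def eventually_at_left_field using r(3) by blast
  next
    assume "bdry_index (germ f) k"
    then obtain b where b: "b < 1" "\<And>\<rho>. b < \<rho> \<Longrightarrow> \<rho> < 1 \<Longrightarrow>
      (\<forall>z\<in>sphere 0 \<rho>. germ f z \<noteq> 0) \<and> circle_wind (germ f) \<rho> = k"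
      unfolding bdry_index_def eventually_at_left_field by blast
    have main: "\<forall>\<rho>\<in>{r<..<1}. (\<forall>z\<in>sphere 0 \<rho>. f r z \<noteq> 0) \<and> wind (\<lambda>\<zeta>. f r (of_real \<rho> * \<zeta>)) = k"
      if "max b r0 < r" for r
    proof
      fix \<rho> assume "\<rho> \<in> {r<..<1}"
      then show "(\<forall>z\<in>sphere 0 \<rho>. f r z \<noteq> 0) \<and> wind (\<lambda>\<zeta>. f r (of_real \<rho> * \<zeta>)) = k"
        using same[of r \<rho>] b(2)[of \<rho>] that by simp
    qed
    have "max b r0 < 1" using b r0 by simp
    then show "has_index f k"
      unfolding has_index_def eventually_at_left_field using main by blast
  qed
qed

lemma disc_Cb_continuous_annulus: "F \<in> disc_Cb \<Longrightarrow> continuous_on (annulus r) F"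
  using continuous_on_subset[OF _ annulus_subset_ball] by (auto simp: disc_Cb_def)

text \<open>Independence of the representative: another representative of the class of \<open>F\<close> differs from
  \<open>F\<close> by less than the lower bound \<open>\<delta>\<close> near the unit circle.\<close>

lemma pi0_has_index:
  assumes F: "F \<in> disc_Cb" and "\<delta> > 0" and bdd: "\<forall>\<^sub>F z in bdry. \<delta> \<le> cmod (F z)"
    and k: "bdry_index F k" and f: "f \<in> \<pi>\<^sub>0 F"
  shows "has_index f k"
proof -
  have f: "f \<in> carrier coherent_alg" "((\<lambda>z. germ f z - F z) \<longlongrightarrow> 0) bdry"
    using f mem_pi0_iff[OF F] by auto
  obtain r0 where r0: "r0 \<in> {0<..<1}" "continuous_on (annulus r0) (germ f)"
    using coherent_germ[OF f(1)] by metis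
  have "\<forall>\<^sub>F z in bdry. cmod (germ f z - F z) < \<delta>"
    using tendstoD[OF f(2) \<open>\<delta> > 0\<close>] by simp
  then have "\<forall>\<^sub>F z in bdry. cmod (germ f z - F z) < cmod (F z)"
    using bdd by eventually_elim simp
  moreover have "continuous_on (annulus 0) F"
    using F by (rule disc_Cb_continuous_annulus)
  ultimately have "bdry_index (germ f) k"
    using r0 k by (intro bdry_index_perturb[of 0 F r0 "germ f" k]) auto
  then show ?thesis using has_index_iff[OF f(1)] by simp
qed

lemma W_pi0:
  assumes F: "F \<in> disc_Cb" and "\<delta> > 0" and bdd: "\<forall>\<^sub>F z in bdry. \<delta> \<le> cmod (F z)"
  shows index_well_defined: "\<exists>!k. \<forall>f\<in>\<pi>\<^sub>0 F. has_index f k"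
    and bdry_index_W: "bdry_index F (W (\<pi>\<^sub>0 F))"
proof -
  obtain r where r: "r \<in> {0<..<1}" "\<forall>z\<in>annulus r. \<delta> \<le> cmod (F z)"
    using bdd unfolding eventually_bdry by blast
  have "continuous_on (annulus r) F"
    using F by (rule disc_Cb_continuous_annulus)
  then obtain k where k: "bdry_index F k"
    using bdry_index_exists[OF r(1), of F] r(2) \<open>\<delta> > 0\<close> by fastforce
  have all: "\<forall>f\<in>\<pi>\<^sub>0 F. has_index f k"
    using pi0_has_index[OF F \<open>\<delta> > 0\<close> bdd k] by blast
  have "restr F \<in> \<pi>\<^sub>0 F"
    unfolding pi0_restr by (rule self_mem_coset[OF restr_carrier[OF F]])
  then have uniq: "l = k" if "\<forall>f\<in>\<pi>\<^sub>0 F. has_index f l" for l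
    using that all has_index_iff[OF restr_carrier[OF F]] bdry_index_unique by blast
  show "\<exists>!k. \<forall>f\<in>\<pi>\<^sub>0 F. has_index f k"
    by (rule ex1I[of _ k]) (use all uniq in blast)+
  have "W (\<pi>\<^sub>0 F) = k"
    unfolding W_def by (rule the_equality) (use all uniq in blast)+
  then show "bdry_index F (W (\<pi>\<^sub>0 F))" using k by simp
qed

lemma W_unit:
  assumes F: "F \<in> disc_Cb" and unit: "\<pi>\<^sub>0 F \<in> Units S_alg"
  shows unit_index_well_defined: "\<exists>!k. \<forall>f\<in>\<pi>\<^sub>0 F. has_index f k"
    and bdry_index_W_unit: "bdry_index F (W (\<pi>\<^sub>0 F))"
    and W_unit_eqI: "bdry_index F k \<Longrightarrow> W (\<pi>\<^sub>0 F) = k"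
proof -
  obtain \<delta> where \<delta>: "\<delta> > 0" "\<forall>\<^sub>F z in bdry. \<delta> \<le> cmod (F z)"
    using S_unit_bounded_below[OF assms] by blast
  show "\<exists>!k. \<forall>f\<in>\<pi>\<^sub>0 F. has_index f k" by (rule index_well_defined[OF F \<delta>])
  show "bdry_index F (W (\<pi>\<^sub>0 F))" by (rule bdry_index_W[OF F \<delta>])
  then show "bdry_index F k \<Longrightarrow> W (\<pi>\<^sub>0 F) = k" by (rule bdry_index_unique)
qed

lemma S_unit_cases:
  assumes "a \<in> Units S_alg"
  obtains F where "F \<in> disc_Cb" "a = \<pi>\<^sub>0 F" "\<pi>\<^sub>0 F \<in> Units S_alg"
proof -
  have "a \<in> carrier S_alg" using assms by (simp add: Units_def)
  then obtain F where "F \<in> disc_Cb" "a = \<pi>\<^sub>0 F" by (rule S_cases)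
  then show ?thesis using that assms by simp
qed

lemma W_mult:
  assumes "a \<in> Units S_alg" "b \<in> Units S_alg"
  shows "W (a \<otimes>\<^bsub>S_alg\<^esub> b) = W a + W b"
proof -
  interpret cring S_alg by (rule S_cring)
  obtain F where F: "F \<in> disc_Cb" "a = \<pi>\<^sub>0 F" "\<pi>\<^sub>0 F \<in> Units S_alg"
    using assms(1) by (rule S_unit_cases)
  obtain G where G: "G \<in> disc_Cb" "b = \<pi>\<^sub>0 G" "\<pi>\<^sub>0 G \<in> Units S_alg"
    using assms(2) by (rule S_unit_cases)
  have eq: "a \<otimes>\<^bsub>S_alg\<^esub> b = \<pi>\<^sub>0 (\<lambda>z. F z * G z)" using F G by (simp add: pi0_ops)
  have "\<pi>\<^sub>0 (\<lambda>z. F z * G z) \<in> Units S_alg"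
    using Units_m_closed[OF assms] unfolding eq .
  moreover have "bdry_index (\<lambda>z. F z * G z) (W a + W b)"
    unfolding F(2) G(2)
    by (rule bdry_index_mult[of 0 F 0 G])
      (simp_all add: disc_Cb_continuous_annulus bdry_index_W_unit F G)
  ultimately show ?thesis
    unfolding eq by (rule W_unit_eqI[OF disc_Cb_intros(1)[OF F(1) G(1)]])
qed

lemma S_star_unit:
  assumes "a \<in> Units S_alg"
  shows "star S_alg a \<in> Units S_alg"
proof -
  interpret cring S_alg by (rule S_cring)
  interpret algebra_involution S_alg by (rule S_involution)
  have one: "star S_alg \<one>\<^bsub>S_alg\<^esub> = \<one>\<^bsub>S_alg\<^esub>"
    by (simp add: pi0_one pi0_ops disc_Cb_const)
  obtain b where b: "a \<in> carrier S_alg" "b \<in> carrier S_alg" "b \<otimes>\<^bsub>S_alg\<^esub> a = \<one>\<^bsub>S_alg\<^esub>" "a \<otimes>\<^bsub>S_alg\<^esub> b = \<one>\<^bsub>S_alg\<^esub>"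
    using assms unfolding Units_def by blast
  have "star S_alg a \<otimes>\<^bsub>S_alg\<^esub> star S_alg b = \<one>\<^bsub>S_alg\<^esub>" "star S_alg b \<otimes>\<^bsub>S_alg\<^esub> star S_alg a = \<one>\<^bsub>S_alg\<^esub>"
    using star_mult[OF b(2,1)] star_mult[OF b(1,2)] b(3,4) one by auto
  then show ?thesis
    unfolding Units_def using star_closed b(1,2) by blast
qed

lemma W_star:
  assumes "a \<in> Units S_alg"
  shows "W (star S_alg a) = - W a"
proof -
  obtain F where F: "F \<in> disc_Cb" "a = \<pi>\<^sub>0 F" "\<pi>\<^sub>0 F \<in> Units S_alg"
    using assms by (rule S_unit_cases)
  have eq: "star S_alg a = \<pi>\<^sub>0 (\<lambda>z. cnj (F z))" using F by (simp add: pi0_ops)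
  have "\<pi>\<^sub>0 (\<lambda>z. cnj (F z)) \<in> Units S_alg" using S_star_unit[OF assms] unfolding eq .
  moreover have "bdry_index (\<lambda>z. cnj (F z)) (- W a)"
    unfolding F(2)
    by (rule bdry_index_cnj[of 0 F]) (simp_all add: disc_Cb_continuous_annulus bdry_index_W_unit F)
  ultimately show ?thesis
    unfolding eq by (rule W_unit_eqI[OF disc_Cb_intros(6)[OF F(1)]])
qed

text \<open>The lower bound of \<open>cmod F\<close> near the unit circle serves as radius: a class at smaller distance
  is represented by a function that Rouche's principle applies to.\<close>

lemma W_locally_constant:
  assumes "a \<in> Units S_alg"
  obtains \<delta> where "\<delta> > 0" "\<And>b. b \<in> Units S_alg \<Longrightarrow> norm_dist S_alg a b < \<delta> \<Longrightarrow> W b = W a"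
proof -
  obtain F where F: "F \<in> disc_Cb" "a = \<pi>\<^sub>0 F" "\<pi>\<^sub>0 F \<in> Units S_alg"
    using assms by (rule S_unit_cases)
  obtain \<delta> where \<delta>: "\<delta> > 0" "\<forall>\<^sub>F z in bdry. \<delta> \<le> cmod (F z)"
    using S_unit_bounded_below[OF F(1,3)] by blast
  have "W b = W a" if b: "b \<in> Units S_alg" and d: "norm_dist S_alg a b < \<delta>" for b
  proof -
    obtain G where G: "G \<in> disc_Cb" "b = \<pi>\<^sub>0 G" "\<pi>\<^sub>0 G \<in> Units S_alg"
      using b by (rule S_unit_cases)
    have "nrm S_alg (\<pi>\<^sub>0 (\<lambda>z. F z - G z)) < \<delta>"
      using d unfolding F(2) G(2) norm_dist_pi0[OF F(1) G(1)] .
    from nrm_pi0_less[OF disc_Cb_intros(3)[OF F(1) G(1)] this] \<delta>(2)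
    have "\<forall>\<^sub>F z in bdry. cmod (G z - F z) < cmod (F z)"
      by eventually_elim (simp add: norm_minus_commute)
    then have "bdry_index G (W a)"
      unfolding F(2)
      by (intro bdry_index_perturb[of 0 F 0 G])
        (simp_all add: disc_Cb_continuous_annulus bdry_index_W_unit F G)
    then show ?thesis unfolding G(2) by (rule W_unit_eqI[OF G(1,3)])
  qed
  with \<delta>(1) show ?thesis by (rule that)
qed

lemma W_continuous:
  "continuous_map (subtopology (norm_topology S_alg) (Units S_alg)) (discrete_topology UNIV) W"
proof -
  interpret Metric_space "carrier S_alg" "norm_dist S_alg" by (rule S_metric)
  let ?T = "subtopology (norm_topology S_alg) (Units S_alg)"
  have top: "topspace ?T = Units S_alg"
    unfolding norm_topology_def by (auto simp: Units_def)
  have "openin ?T {x \<in> Units S_alg. W x \<in> U}" for U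
    unfolding openin_subopen[of ?T "{x \<in> Units S_alg. W x \<in> U}"]
  proof
    fix a assume "a \<in> {x \<in> Units S_alg. W x \<in> U}"
    then have a: "a \<in> Units S_alg" "W a \<in> U" by auto
    obtain \<delta> where \<delta>: "\<delta> > 0" "\<And>b. b \<in> Units S_alg \<Longrightarrow> norm_dist S_alg a b < \<delta> \<Longrightarrow> W b = W a"
      using W_locally_constant[OF a(1)] by blast
    have "openin ?T (Units S_alg \<inter> mball a \<delta>)"
      unfolding norm_topology_def by (intro openin_subtopology_Int2 openin_mball)
    moreover have "a \<in> Units S_alg \<inter> mball a \<delta>"
      using a \<delta>(1) by (auto simp: Units_def)
    moreover have "Units S_alg \<inter> mball a \<delta> \<subseteq> {x \<in> Units S_alg. W x \<in> U}"
      using a(2) \<delta>(2) by auto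
    ultimately show "\<exists>T. openin ?T T \<and> a \<in> T \<and> T \<subseteq> {x \<in> Units S_alg. W x \<in> U}" by blast
  qed
  then show ?thesis unfolding continuous_map_def top by simp
qed

section \<open>Bounded holomorphic functions\<close>

lemma H_inf_carrier:
  "f \<in> carrier H_inf \<longleftrightarrow>
    f \<in> extensional (ball 0 1) \<and> f holomorphic_on ball 0 1 \<and> bounded (f ` ball 0 1)"
  by (simp add: H_inf_def)

lemma H_inf_disc_Cb: "f \<in> carrier H_inf \<Longrightarrow> f \<in> disc_Cb"
  by (simp add: H_inf_carrier disc_Cb_def holomorphic_on_imp_continuous_on)

lemma H_inf_simps:
  "f \<otimes>\<^bsub>H_inf\<^esub> g = (\<lambda>z\<in>ball 0 1. f z * g z)"
  "f \<oplus>\<^bsub>H_inf\<^esub> g = (\<lambda>z\<in>ball 0 1. f z + g z)"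
  "c \<odot>\<^bsub>H_inf\<^esub> f = (\<lambda>z\<in>ball 0 1. c * f z)"
  "\<one>\<^bsub>H_inf\<^esub> = (\<lambda>z\<in>ball 0 1. 1)"
  "\<zero>\<^bsub>H_inf\<^esub> = (\<lambda>z\<in>ball 0 1. 0)"
  by (simp_all add: H_inf_def)

lemma H_inf_eqI:
  assumes "f \<in> carrier H_inf" "g \<in> carrier H_inf" "\<And>z. z \<in> ball 0 1 \<Longrightarrow> f z = g z"
  shows "f = g"
  by (rule extensionalityI[of _ "ball 0 1"]) (use assms in \<open>auto simp: H_inf_carrier\<close>)

lemma H_inf_restrictI:
  assumes "f holomorphic_on ball 0 1" "f \<in> disc_Cb"
  shows "restrict f (ball 0 1) \<in> carrier H_inf"
proof -
  have "restrict f (ball 0 1) holomorphic_on ball 0 1"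
    by (rule holomorphic_transform[OF assms(1)]) simp
  moreover have "restrict f (ball 0 1) ` ball 0 1 = f ` ball 0 1" by (rule image_cong) auto
  ultimately show ?thesis using assms(2) by (simp add: H_inf_carrier disc_Cb_def)
qed

lemma H_inf_closed:
  assumes f: "f \<in> carrier H_inf"
  shows "g \<in> carrier H_inf \<Longrightarrow> f \<otimes>\<^bsub>H_inf\<^esub> g \<in> carrier H_inf"
    and "g \<in> carrier H_inf \<Longrightarrow> f \<oplus>\<^bsub>H_inf\<^esub> g \<in> carrier H_inf"
    and "c \<odot>\<^bsub>H_inf\<^esub> f \<in> carrier H_inf"
proof -
  have hol: "h holomorphic_on ball 0 1" if "h \<in> carrier H_inf" for h
    using that by (simp add: H_inf_carrier)
  show "f \<otimes>\<^bsub>H_inf\<^esub> g \<in> carrier H_inf" "f \<oplus>\<^bsub>H_inf\<^esub> g \<in> carrier H_inf" if g: "g \<in> carrier H_inf"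
    unfolding H_inf_simps
    by (intro H_inf_restrictI holomorphic_intros disc_Cb_intros hol H_inf_disc_Cb f g)+
  show "c \<odot>\<^bsub>H_inf\<^esub> f \<in> carrier H_inf"
    unfolding H_inf_simps
    by (intro H_inf_restrictI holomorphic_intros disc_Cb_intros hol H_inf_disc_Cb f)
qed

lemma H_inf_const_closed: "\<one>\<^bsub>H_inf\<^esub> \<in> carrier H_inf" "\<zero>\<^bsub>H_inf\<^esub> \<in> carrier H_inf"
  unfolding H_inf_simps by (intro H_inf_restrictI holomorphic_intros disc_Cb_const)+

lemma H_inf_at:
  assumes "z \<in> ball 0 1"
  shows "(f \<otimes>\<^bsub>H_inf\<^esub> g) z = f z * g z" "(f \<oplus>\<^bsub>H_inf\<^esub> g) z = f z + g z"
    "(c \<odot>\<^bsub>H_inf\<^esub> f) z = c * f z" "\<one>\<^bsub>H_inf\<^esub> z = 1" "\<zero>\<^bsub>H_inf\<^esub> z = 0"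
  using assms by (simp_all add: H_inf_simps)

lemma H_inf_cring: "cring H_inf"
proof (intro cringI abelian_groupI comm_monoidI)
  fix x assume x: "x \<in> carrier H_inf"
  have "(-1) \<odot>\<^bsub>H_inf\<^esub> x \<oplus>\<^bsub>H_inf\<^esub> x = \<zero>\<^bsub>H_inf\<^esub>"
    by (rule H_inf_eqI; simp add: x H_inf_closed H_inf_const_closed H_inf_at)
  then show "\<exists>y\<in>carrier H_inf. y \<oplus>\<^bsub>H_inf\<^esub> x = \<zero>\<^bsub>H_inf\<^esub>"
    using H_inf_closed(3)[OF x] by blast
qed (simp add: H_inf_closed H_inf_const_closed |
    (rule H_inf_eqI; simp add: H_inf_closed H_inf_const_closed H_inf_at algebra_simps))+

text \<open>If \<open>b\<close> is not zero, then \<open>a\<close> vanishes on the nonempty open set where \<open>b\<close> does not, hence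
  everywhere by analytic continuation.\<close>

lemma H_inf_domain: "domain H_inf"
proof (intro domain.intro domain_axioms.intro H_inf_cring)
  show "\<one>\<^bsub>H_inf\<^esub> \<noteq> \<zero>\<^bsub>H_inf\<^esub>"
    using H_inf_at(4,5)[of 0] by auto
next
  fix a b assume ab: "a \<otimes>\<^bsub>H_inf\<^esub> b = \<zero>\<^bsub>H_inf\<^esub>" and a: "a \<in> carrier H_inf" and b: "b \<in> carrier H_inf"
  show "a = \<zero>\<^bsub>H_inf\<^esub> \<or> b = \<zero>\<^bsub>H_inf\<^esub>"
  proof (rule disjCI)
    assume "b \<noteq> \<zero>\<^bsub>H_inf\<^esub>"
    then obtain p where p: "p \<in> ball 0 1" "b p \<noteq> 0"
      using H_inf_eqI[OF b H_inf_const_closed(2)] H_inf_at(5) by metis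
    define U where "U = {z \<in> ball 0 1. b z \<noteq> 0}"
    have "continuous_on (ball 0 1) b" using H_inf_disc_Cb[OF b] by (simp add: disc_Cb_def)
    then have "open U"
      unfolding U_def using continuous_open_preimage[of "ball 0 1" b "- {0}"]
      by (simp add: vimage_def Int_def open_Compl)
    have zero: "a z = 0" if "z \<in> U" for z
    proof -
      have z: "z \<in> ball 0 1" "b z \<noteq> 0" using that by (auto simp: U_def)
      have "a z * b z = 0"
        using arg_cong[OF ab, of "\<lambda>h. h z"] by (simp only: H_inf_at[OF z(1)])
      then show ?thesis using z(2) by simp
    qed
    have "a z = 0" if "z \<in> ball 0 1" for z
    proof (rule analytic_continuation_open[of U "ball 0 1" a "\<lambda>_. 0"])
      show "a holomorphic_on ball 0 1" using a by (simp add: H_inf_carrier)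
    qed (use \<open>open U\<close> p zero that in \<open>auto simp: U_def\<close>)
    then show "a = \<zero>\<^bsub>H_inf\<^esub>"
      by (intro H_inf_eqI[OF a H_inf_const_closed(2)]) (simp add: H_inf_at)
  qed
qed

lemma pi0_cong:
  assumes "\<And>z. z \<in> ball 0 1 \<Longrightarrow> F z = G z"
  shows "\<pi>\<^sub>0 F = \<pi>\<^sub>0 G"
proof -
  have "restrict F (annulus r) = restrict G (annulus r)" for r
    using assms annulus_subset_ball by (intro restrict_ext) blast
  then show ?thesis by (simp add: \<pi>\<^sub>0_def)
qed

lemma pi0_ring_hom: "\<pi>\<^sub>0 \<in> ring_hom H_inf S_alg"
proof (rule ring_hom_memI)
  show "\<pi>\<^sub>0 x \<in> carrier S_alg" if "x \<in> carrier H_inf" for x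
    using pi0_carrier[OF H_inf_disc_Cb[OF that]] .
  fix x y assume xy: "x \<in> carrier H_inf" "y \<in> carrier H_inf"
  have "\<pi>\<^sub>0 (x \<otimes>\<^bsub>H_inf\<^esub> y) = \<pi>\<^sub>0 (\<lambda>z. x z * y z)" "\<pi>\<^sub>0 (x \<oplus>\<^bsub>H_inf\<^esub> y) = \<pi>\<^sub>0 (\<lambda>z. x z + y z)"
    by (rule pi0_cong, simp add: H_inf_simps)+
  then show "\<pi>\<^sub>0 (x \<otimes>\<^bsub>H_inf\<^esub> y) = \<pi>\<^sub>0 x \<otimes>\<^bsub>S_alg\<^esub> \<pi>\<^sub>0 y" "\<pi>\<^sub>0 (x \<oplus>\<^bsub>H_inf\<^esub> y) = \<pi>\<^sub>0 x \<oplus>\<^bsub>S_alg\<^esub> \<pi>\<^sub>0 y"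
    using xy by (simp_all add: pi0_ops H_inf_disc_Cb)
next
  show "\<pi>\<^sub>0 \<one>\<^bsub>H_inf\<^esub> = \<one>\<^bsub>S_alg\<^esub>"
    unfolding pi0_one by (rule pi0_cong) (simp add: H_inf_simps)
qed

lemma pi0_smult:
  assumes "f \<in> carrier H_inf"
  shows "\<pi>\<^sub>0 (c \<odot>\<^bsub>H_inf\<^esub> f) = c \<odot>\<^bsub>S_alg\<^esub> \<pi>\<^sub>0 f"
proof -
  have "\<pi>\<^sub>0 (c \<odot>\<^bsub>H_inf\<^esub> f) = \<pi>\<^sub>0 (\<lambda>z. c * f z)"
    by (rule pi0_cong) (simp add: H_inf_simps)
  then show ?thesis using assms by (simp add: pi0_ops H_inf_disc_Cb)
qed

text \<open>The maximum modulus principle on closed discs whose boundary circles approach the unit circle.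
  It is the reason why \<^const>\<open>\<pi>\<^sub>0\<close> is injective on \<^const>\<open>H_inf\<close>, although it is not on
  all bounded continuous functions.\<close>

lemma holomorphic_zero_if_null:
  assumes hol: "h holomorphic_on ball 0 1" and lim: "(h \<longlongrightarrow> 0) bdry" and z: "z \<in> ball 0 1"
  shows "h z = 0"
proof -
  have "cmod (h z) \<le> e" if "e > 0" for e
  proof -
    have "\<forall>\<^sub>F z in bdry. cmod (h z) < e" using tendstoD[OF lim that] by simp
    then obtain r where r: "r \<in> {0<..<1}" "\<forall>z\<in>annulus r. cmod (h z) < e"
      unfolding eventually_bdry by blast
    define \<rho> where "\<rho> = (max r (cmod z) + 1) / 2"
    have \<rho>: "r < \<rho>" "cmod z < \<rho>" "\<rho> < 1" "0 < \<rho>" using r z by (auto simp: \<rho>_def)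
    have sub: "cball 0 \<rho> \<subseteq> ball (0::complex) 1" using \<rho> by auto
    show ?thesis
    proof (rule maximum_modulus_frontier[of h "cball 0 \<rho>"])
      show "h holomorphic_on interior (cball 0 \<rho>)"
        by (rule holomorphic_on_subset[OF hol order_trans[OF interior_subset sub]])
      show "continuous_on (closure (cball 0 \<rho>)) h"
        using holomorphic_on_imp_continuous_on[OF holomorphic_on_subset[OF hol sub]] by simp
      show "cmod (h w) \<le> e" if "w \<in> frontier (cball 0 \<rho>)" for w
      proof -
        have "w \<in> annulus r" using that \<rho> by (auto simp: frontier_cball annulus_def)
        then show ?thesis using r(2) by (auto intro: less_imp_le)
      qed
    qed (use \<rho> in auto)
  qed
  then have "cmod (h z) \<le> 0" by (rule field_le_epsilon) simp
  then show ?thesis by simp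
qed

lemma pi0_inj: "inj_on \<pi>\<^sub>0 (carrier H_inf)"
proof (rule inj_onI)
  fix f g assume f: "f \<in> carrier H_inf" and g: "g \<in> carrier H_inf" and eq: "\<pi>\<^sub>0 f = \<pi>\<^sub>0 g"
  have lim: "((\<lambda>z. f z - g z) \<longlongrightarrow> 0) bdry"
    using eq unfolding pi0_eq_iff[OF H_inf_disc_Cb[OF f] H_inf_disc_Cb[OF g]] .
  have "(\<lambda>z. f z - g z) holomorphic_on ball 0 1"
    using f g by (intro holomorphic_intros) (auto simp: H_inf_carrier)
  then have "f z - g z = 0" if "z \<in> ball 0 1" for z
    using holomorphic_zero_if_null lim that by blast
  then show "f = g" by (intro H_inf_eqI[OF f g]) simp
qed

section \<open>Invertibility and the index\<close>

text \<open>The image of a circle contracts, within the image of the disc, to a constant loop.\<close>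

lemma circle_wind_zero_if_nonvanishing:
  assumes cont: "continuous_on (ball 0 1) f" and nz: "\<And>z. z \<in> ball 0 1 \<Longrightarrow> f z \<noteq> 0"
    and \<rho>: "0 < \<rho>" "\<rho> < 1"
  shows "circle_wind f \<rho> = 0"
proof -
  have "homotopic_loops (ball 0 1) (circlepath 0 \<rho>) (\<lambda>t. 0)"
  proof (rule homotopic_loops_linear)
    fix t :: real assume "t \<in> {0..1}"
    then have "circlepath 0 \<rho> t \<in> ball 0 1"
      using circlepath_in_sphere[of \<rho> t] \<rho> by auto
    then show "closed_segment (circlepath 0 \<rho> t) 0 \<subseteq> ball 0 1"
      by (intro closed_segment_subset convex_ball) auto
  qed (simp_all add: path_def[of "\<lambda>t. 0"] pathfinish_def[of "\<lambda>t. 0"] pathstart_def[of "\<lambda>t. 0"])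
  then have "homotopic_loops (- {0}) (f \<circ> circlepath 0 \<rho>) (f \<circ> (\<lambda>t. 0))"
    by (rule homotopic_loops_continuous_image[OF _ cont]) (use nz in auto)
  then have "winding_number (f \<circ> circlepath 0 \<rho>) 0 = winding_number (f \<circ> (\<lambda>t. 0)) 0"
    by (rule winding_number_homotopic_loops)
  also have "f \<circ> (\<lambda>t. 0) = (\<lambda>t::real. f 0)" by auto
  also have "winding_number (\<lambda>t::real. f 0) 0 = 0"
    by (rule winding_number_zero_const) (use nz in auto)
  finally have "winding_number (f \<circ> circlepath 0 \<rho>) 0 = 0" .
  moreover have "of_int (circle_wind f \<rho>) = winding_number (f \<circ> circlepath 0 \<rho>) 0"
    using \<rho> nz by (intro of_int_circle_wind continuous_on_subset[OF cont]) auto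
  ultimately show ?thesis by simp
qed

text \<open>By the argument principle the winding number is the number of zeros inside the circle, counted
  with multiplicity. Here the argument principle gives the contour integral of the logarithmic
  derivative, which a change of variables identifies with the winding number of the image curve.\<close>

lemma nonvanishing_if_circle_wind_zero:
  assumes hol: "f holomorphic_on ball 0 1"
    and r: "0 < r" "r < \<rho>" "\<rho> < 1"
    and nz: "\<And>z. z \<in> annulus r \<Longrightarrow> f z \<noteq> 0" and w0: "circle_wind f \<rho> = 0"
    and z: "z \<in> ball 0 1"
  shows "f z \<noteq> 0"
proof -
  define Z where "Z = {w \<in> ball 0 1. f w = 0}"
  have Z: "cmod w < \<rho>" if "w \<in> Z" for w
  proof (rule ccontr)
    assume "\<not> cmod w < \<rho>"
    then have "w \<in> annulus r" using that r by (auto simp: Z_def annulus_def)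
    then show False using nz that by (auto simp: Z_def)
  qed
  have sph: "sphere 0 \<rho> \<subseteq> annulus r" using r by (intro sphere_subset_annulus)
  have img: "path_image (circlepath 0 \<rho>) = sphere 0 \<rho>" using r by simp
  have nzs: "f w \<noteq> 0" if "w \<in> sphere 0 \<rho>" for w using that sph nz by blast
  have sph1: "sphere 0 \<rho> \<subseteq> ball (0::complex) 1" using r by auto
  have "of_real \<rho> \<in> sphere (0::complex) \<rho>" using r by simp
  then have non0: "f (of_real \<rho>) \<noteq> 0" by (rule nzs)
  have fin: "finite Z"
  proof (cases "f constant_on ball 0 1")
    case True
    then have "Z = {}" using non0 r unfolding constant_on_def Z_def by force
    then show ?thesis by simp
  next
    case False
    have "finite {w \<in> cball 0 \<rho>. f w = 0}"
      by (rule holomorphic_compact_finite_zeros[OF hol]) (use r False in auto)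
    then show ?thesis by (rule finite_subset[rotated]) (use Z in \<open>force simp: Z_def\<close>)
  qed
  have vf: "valid_path (f \<circ> circlepath 0 \<rho>)"
    by (rule valid_path_compose_holomorphic[OF _ hol]) (use img sph1 in auto)
  have "winding_number (f \<circ> circlepath 0 \<rho>) 0 = 0"
    using of_int_circle_wind[of \<rho> f] w0 r nzs
      holomorphic_on_imp_continuous_on[OF holomorphic_on_subset[OF hol sph1]] by simp
  moreover have "winding_number (f \<circ> circlepath 0 \<rho>) 0 =
      1 / (2 * pi * \<i>) * contour_integral (f \<circ> circlepath 0 \<rho>) (\<lambda>w. 1 / (w - 0))"
    by (rule winding_number_valid_path[OF vf]) (use img nzs in \<open>auto simp: path_image_compose\<close>)
  ultimately have "contour_integral (f \<circ> circlepath 0 \<rho>) (\<lambda>w. 1 / w) = 0" by simp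
  moreover have "contour_integral (f \<circ> circlepath 0 \<rho>) (\<lambda>w. 1 / w) =
      contour_integral (circlepath 0 \<rho>) (\<lambda>w. deriv f w * (1 / f w))"
    by (rule contour_integral_comp_analyticW[of f "ball 0 1"])
      (use hol img sph1 in \<open>auto simp: analytic_on_open\<close>)
  moreover have "contour_integral (circlepath 0 \<rho>) (\<lambda>w. deriv f w * 1 / f w) =
      2 * pi * \<i> * (\<Sum>p\<in>{w \<in> ball 0 1. f w = 0 \<or> w \<in> {}}. winding_number (circlepath 0 \<rho>) p * 1 * zorder f p)"
  proof (rule argument_principle)
    show "\<forall>z. z \<notin> ball 0 1 \<longrightarrow> winding_number (circlepath 0 \<rho>) z = 0"
    proof (intro allI impI)
      fix z :: complex assume "z \<notin> ball 0 1"
      then show "winding_number (circlepath 0 \<rho>) z = 0"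
        by (intro winding_number_zero_outside[of _ "ball 0 1"]) (use img sph1 in auto)
    qed
    show "path_image (circlepath 0 \<rho>) \<subseteq> ball 0 1 - {w \<in> ball 0 1. f w = 0 \<or> w \<in> {}}"
      using img sph1 nzs by auto
    show "finite {w \<in> ball 0 1. f w = 0 \<or> w \<in> {}}" using fin by (simp add: Z_def)
  qed (use hol in auto)
  moreover have "{w \<in> ball 0 1. f w = 0 \<or> w \<in> {}} = Z" by (simp add: Z_def)
  moreover have "(\<Sum>p\<in>Z. winding_number (circlepath 0 \<rho>) p * 1 * zorder f p) = of_int (\<Sum>p\<in>Z. zorder f p)"
    unfolding of_int_sum
  proof (rule sum.cong)
    fix p assume "p \<in> Z"
    then have "winding_number (circlepath 0 \<rho>) p = 1"
      using Z by (intro winding_number_circlepath) simp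
    then show "winding_number (circlepath 0 \<rho>) p * 1 * of_int (zorder f p) = of_int (zorder f p)" by simp
  qed simp
  ultimately have "(of_int (\<Sum>p\<in>Z. zorder f p) :: complex) = 0" by simp
  then have sum0: "(\<Sum>p\<in>Z. zorder f p) = 0" by (simp only: of_int_eq_0_iff)
  have pos: "zorder f p > 0" if "p \<in> Z" for p
  proof -
    have "\<exists>w\<in>ball 0 1. f w \<noteq> 0" using non0 r by (intro bexI[of _ "of_real \<rho>"]) auto
    then show ?thesis
      using zorder_exist_zero[OF hol open_ball connected_ball, of p] that by (simp add: Z_def)
  qed
  have "Z = {}"
  proof (rule ccontr)
    assume "Z \<noteq> {}"
    then have "(\<Sum>p\<in>Z. zorder f p) > 0" using fin pos by (intro sum_pos) auto
    then show False using sum0 by simp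
  qed
  then show ?thesis using z by (auto simp: Z_def)
qed

text \<open>The inverse is bounded near the unit circle by the lower bound \<open>\<delta>\<close>, and on the remaining
  closed disc by compactness.\<close>

lemma H_inf_unitI:
  assumes x: "x \<in> carrier H_inf" and nz: "\<And>z. z \<in> ball 0 1 \<Longrightarrow> x z \<noteq> 0"
    and \<delta>: "\<delta> > 0" "\<forall>\<^sub>F z in bdry. \<delta> \<le> cmod (x z)"
  shows "x \<in> Units H_inf"
proof -
  have hol: "x holomorphic_on ball 0 1" using x by (simp add: H_inf_carrier)
  have cont: "continuous_on (ball 0 1) x" using H_inf_disc_Cb[OF x] by (simp add: disc_Cb_def)
  obtain r where r: "r \<in> {0<..<1}" "\<And>z. z \<in> annulus r \<Longrightarrow> \<delta> \<le> cmod (x z)"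
    using \<delta>(2) unfolding eventually_bdry by blast
  define y where "y z = inverse (x z)" for z
  have ycont: "continuous_on (ball 0 1) y"
    unfolding y_def by (rule continuous_on_inverse[OF cont]) (use nz in blast)
  have yhol: "y holomorphic_on ball 0 1"
    unfolding y_def by (rule holomorphic_on_inverse[OF hol nz])
  have "compact (y ` cball 0 r)"
    by (rule compact_continuous_image[OF continuous_on_subset[OF ycont]]) (use r in auto)
  then have "bounded (y ` cball 0 r)" by (rule compact_imp_bounded)
  then obtain B where B: "\<And>z. z \<in> cball 0 r \<Longrightarrow> cmod (y z) \<le> B"
    unfolding bounded_iff by blast
  have yB: "cmod (y z) \<le> max B (inverse \<delta>)" if "z \<in> ball 0 1" for z
  proof (cases "z \<in> cball 0 r")
    case True
    then show ?thesis using B[OF True] by linarith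
  next
    case False
    then have "z \<in> annulus r" using that by (simp add: annulus_def)
    then have "inverse (cmod (x z)) \<le> inverse \<delta>"
      by (intro le_imp_inverse_le r(2) \<delta>(1))
    then show ?thesis unfolding y_def norm_inverse by linarith
  qed
  define v where "v = restrict y (ball 0 1)"
  have v: "v \<in> carrier H_inf"
    unfolding v_def by (rule H_inf_restrictI[OF yhol disc_Cb_I[OF ycont yB]])
  have xv: "x \<otimes>\<^bsub>H_inf\<^esub> v = \<one>\<^bsub>H_inf\<^esub>"
  proof (rule H_inf_eqI[OF H_inf_closed(1)[OF x v] H_inf_const_closed(1)])
    fix z :: complex assume z: "z \<in> ball 0 1"
    show "(x \<otimes>\<^bsub>H_inf\<^esub> v) z = \<one>\<^bsub>H_inf\<^esub> z"
      unfolding H_inf_at[OF z] v_def restrict_apply'[OF z] y_def by (rule right_inverse[OF nz[OF z]])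
  qed
  have vx: "v \<otimes>\<^bsub>H_inf\<^esub> x = x \<otimes>\<^bsub>H_inf\<^esub> v"
    unfolding H_inf_simps by (simp only: mult.commute)
  show ?thesis
    unfolding Units_def using x v xv vx by auto
qed

lemma H_inf_unit_iff:
  assumes x: "x \<in> carrier H_inf" and unit: "\<pi>\<^sub>0 x \<in> Units S_alg"
  shows "x \<in> Units H_inf \<longleftrightarrow> W (\<pi>\<^sub>0 x) = 0"
proof
  assume "x \<in> Units H_inf"
  then obtain y where y: "y \<in> carrier H_inf" "x \<otimes>\<^bsub>H_inf\<^esub> y = \<one>\<^bsub>H_inf\<^esub>"
    unfolding Units_def by blast
  have nz: "x z \<noteq> 0" if "z \<in> ball 0 1" for z
    using arg_cong[OF y(2), of "\<lambda>h. h z"] H_inf_at[OF that] by auto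
  have cont: "continuous_on (ball 0 1) x" using H_inf_disc_Cb[OF x] by (simp add: disc_Cb_def)
  have "(\<forall>z\<in>sphere 0 \<rho>. x z \<noteq> 0) \<and> circle_wind x \<rho> = 0" if "0 < \<rho>" "\<rho> < 1" for \<rho>
    using circle_wind_zero_if_nonvanishing[OF cont nz that] nz that by simp
  then have "bdry_index x 0"
    unfolding bdry_index_def eventually_at_left_field by (intro exI[of _ 0]) simp
  then show "W (\<pi>\<^sub>0 x) = 0" by (rule W_unit_eqI[OF H_inf_disc_Cb[OF x] unit])
next
  assume W0: "W (\<pi>\<^sub>0 x) = 0"
  have hol: "x holomorphic_on ball 0 1" using x by (simp add: H_inf_carrier)
  obtain \<delta> where \<delta>: "\<delta> > 0" "\<forall>\<^sub>F z in bdry. \<delta> \<le> cmod (x z)"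
    using S_unit_bounded_below[OF H_inf_disc_Cb[OF x] unit] by blast
  obtain r where r: "r \<in> {0<..<1}" "\<And>z. z \<in> annulus r \<Longrightarrow> \<delta> \<le> cmod (x z)"
    using \<delta>(2) unfolding eventually_bdry by blast
  have nza: "x z \<noteq> 0" if "z \<in> annulus r" for z using r(2)[OF that] \<delta>(1) by auto
  have "bdry_index x 0" using bdry_index_W_unit[OF H_inf_disc_Cb[OF x] unit] W0 by simp
  then obtain b where b: "b < 1" "\<And>\<rho>. b < \<rho> \<Longrightarrow> \<rho> < 1 \<Longrightarrow> circle_wind x \<rho> = 0"
    unfolding bdry_index_def eventually_at_left_field by blast
  define \<rho> where "\<rho> = (max b r + 1) / 2"
  have \<rho>: "b < \<rho>" "r < \<rho>" "\<rho> < 1" using b(1) r(1) by (auto simp: \<rho>_def)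
  have nz: "x z \<noteq> 0" if "z \<in> ball 0 1" for z
    by (rule nonvanishing_if_circle_wind_zero[OF hol _ \<rho>(2,3) nza b(2)[OF \<rho>(1,3)] that]) (use r in auto)
  show "x \<in> Units H_inf" by (rule H_inf_unitI[OF x nz \<delta>])
qed

theorem mainTheorem1:
  shows
    "\<comment> \<open>\<open>W\<close> is well defined\<close>
     (\<forall>a\<in>Units S_alg. \<exists>!k. \<forall>f\<in>a. has_index f k) \<and>
     \<comment> \<open>(A1)\<close>
     domain H_inf \<and>
     \<comment> \<open>(A2)\<close>
     unital_commutative_banach_algebra S_alg \<and>
     semisimple S_alg \<and>
     algebra_involution S_alg \<and>
     \<pi>\<^sub>0 \<in> ring_hom H_inf S_alg \<and>
     (\<forall>c. \<forall>f\<in>carrier H_inf. \<pi>\<^sub>0 (c \<odot>\<^bsub>H_inf\<^esub> f) = c \<odot>\<^bsub>S_alg\<^esub> \<pi>\<^sub>0 f) \<and>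
     inj_on \<pi>\<^sub>0 (carrier H_inf) \<and>
     \<comment> \<open>(A3)\<close>
     (\<forall>a\<in>Units S_alg. \<forall>b\<in>Units S_alg. W (a \<otimes>\<^bsub>S_alg\<^esub> b) = W a + W b) \<and>
     (\<forall>a\<in>Units S_alg. W (star S_alg a) = - W a) \<and>
     continuous_map (subtopology (norm_topology S_alg) (Units S_alg)) (discrete_topology UNIV) W \<and>
     \<comment> \<open>(A4)\<close>
     (\<forall>x\<in>carrier H_inf. \<pi>\<^sub>0 x \<in> Units S_alg \<longrightarrow>
        (x \<in> Units H_inf \<longleftrightarrow> W (\<pi>\<^sub>0 x) = 0))"
proof (intro conjI)
  show "\<forall>a\<in>Units S_alg. \<exists>!k. \<forall>f\<in>a. has_index f k"
    using S_unit_cases unit_index_well_defined by metis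
qed (use H_inf_domain S_banach S_semisimple S_involution pi0_ring_hom pi0_smult pi0_inj
    W_mult W_star W_continuous H_inf_unit_iff in blast)+

end
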